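(* For every integer $n \geq 3$ and every $\varepsilon > 0$ there is a homogeneous monostable convex polyhedron $P \subset \mathbb{R}^3$ such that $P$ has an $n$-fold rotational symmetry and $d_H(P, \mathbf{B}^3) < \varepsilon$.
   Context: A convex body is a compact, convex set with nonempty interior; a convex polyhedron is a convex body in $\mathbb{R}^3$ that is the convex hull of finitely many points. $\mathbf{B}^3$ is the closed unit ball of $\mathbb{R}^3$ centered at the origin, and $d_H$ is the Hausdorff distance. Homogeneous means of uniform density, i.e. the center of mass is $c(P)=\frac{1}{\mathrm{vol}(P)}\int_{P} x\,dv$, where $v$ is 3-dimensional Lebesgue measure. A point $q \in \mathrm{bd}(P)$ is an equilibrium point of $P$ if the plane through $q$ orthogonal to $q-c(P)$ supports $P$. A stable point of a convex polyhedron $P$ is an equilibrium point lying in the relative interior of a (2-dimensional) face of $P$. A convex polyhedron is monostable if it can rest in stable position (on a horizontal plane) only on one of its faces, i.e. if it has exactly one stable point. $P$ has an $n$-fold rotational symmetry if there is a line $\ell$ such that $P$ is invariant under the rotation about $\ell$ by angle $2\pi/n$. *)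

theory Defs
  imports "HOL-Analysis.Analysis"
begin

definition convex_body :: "'a::euclidean_space set \<Rightarrow> bool" where
  "convex_body K \<longleftrightarrow> compact K \<and> convex K \<and> interior K \<noteq> {}"

definition convex_polyhedron :: "(real^3) set \<Rightarrow> bool" where
  "convex_polyhedron P \<longleftrightarrow> convex_body P \<and> polytope P"

text \<open>Meaningful for nonempty bounded sets only: \<^const>\<open>Sup\<close> on the reals is unspecified
  for unbounded sets, and \<^const>\<open>infdist\<close> to the empty set is 0.\<close>

definition hausdorff_dist :: "'a::metric_space set \<Rightarrow> 'a set \<Rightarrow> real" where
  "hausdorff_dist A B = max (SUP a\<in>A. infdist a B) (SUP b\<in>B. infdist b A)"

definition center_of_mass :: "'a::euclidean_space set \<Rightarrow> 'a" where
  "center_of_mass K = (1 / measure lebesgue K) *\<^sub>R (LINT x:K|lebesgue. x)"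

definition supporting_hyperplane :: "'a::euclidean_space set \<Rightarrow> 'a set \<Rightarrow> bool" where
  "supporting_hyperplane H K \<longleftrightarrow>
     (\<exists>a b. a \<noteq> 0 \<and> H = {x. a \<bullet> x = b} \<and> K \<subseteq> {x. a \<bullet> x \<le> b} \<and> H \<inter> K \<noteq> {})"

text \<open>If \<open>q\<close> is the center of mass, the set below is the whole space, which is not a
  hyperplane, so such a \<open>q\<close> is never an equilibrium point.\<close>

definition equilibrium_point :: "'a::euclidean_space set \<Rightarrow> 'a \<Rightarrow> bool" where
  "equilibrium_point K q \<longleftrightarrow>
     q \<in> frontier K \<and>
     supporting_hyperplane {x. (q - center_of_mass K) \<bullet> (x - q) = 0} K"

definition stable_point :: "(real^3) set \<Rightarrow> real^3 \<Rightarrow> bool" where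
  "stable_point P q \<longleftrightarrow>
     equilibrium_point P q \<and> (\<exists>F. F face_of P \<and> aff_dim F = 2 \<and> q \<in> rel_interior F)"

definition monostable :: "(real^3) set \<Rightarrow> bool" where
  "monostable P \<longleftrightarrow> (\<exists>!q. stable_point P q)"

text \<open>Rodrigues' formula for the rotation by angle \<open>t\<close> about the line through \<open>p\<close> with
  direction \<open>u\<close>, where \<open>u\<close> must be a unit vector.\<close>

definition rotation_about :: "real^3 \<Rightarrow> real^3 \<Rightarrow> real \<Rightarrow> real^3 \<Rightarrow> real^3" where
  "rotation_about p u t x =
     p + cos t *\<^sub>R (x - p) + sin t *\<^sub>R cross3 u (x - p)
       + ((1 - cos t) * (u \<bullet> (x - p))) *\<^sub>R u"

lemma rotation_about_third_axis:
  "rotation_about 0 (axis 3 1) t x =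
     vector [cos t * x$1 - sin t * x$2, sin t * x$1 + cos t * x$2, x$3]"
  by (simp add: rotation_about_def cross3_def vec_eq_iff forall_3 inner_vec_def sum_3 axis_def
      algebra_simps)

lemma rotation_about_fixes_axis: "norm u = 1 \<Longrightarrow> rotation_about p u t (p + s *\<^sub>R u) = p + s *\<^sub>R u"
  by (simp add: rotation_about_def cross_mult_right norm_eq_1 algebra_simps)

definition has_rotational_symmetry :: "nat \<Rightarrow> (real^3) set \<Rightarrow> bool" where
  "has_rotational_symmetry n P \<longleftrightarrow>
     (\<exists>p u. norm u = 1 \<and> rotation_about p u (2 * pi / real n) ` P = P)"

end

theory Submission
  imports Defs
begin

text \<open>
  Write a polyhedron around its center of mass \<open>0\<close> as an intersection of half-spaces
  \<open>u \<bullet> x \<le> b\<close> with unit normals \<open>u\<close> and heights \<open>b > 0\<close>.  It rests stably on the face with normal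
  \<open>u\<close> exactly when the foot \<open>b u\<close> of the perpendicular from \<open>0\<close> satisfies all the other
  inequalities strictly.  So a facet \<open>(u, b)\<close> is not stable as soon as some other facet
  \<open>(v, d)\<close> has \<open>d \<le> b (v \<bullet> u)\<close>, and the body is monostable if every facet except one root can
  descend in this sense to another facet (\<open>monostable_if_descending\<close>).  A step between
  directions at angle \<open>\<delta>\<close> only requires the heights to drop by the factor \<open>cos \<delta>\<close>; a path of
  \<open>O(1/\<delta>)\<close> such steps costs a factor \<open>1 - O(\<delta>)\<close>.  Hence on a fine net of directions descending
  paths are compatible with heights arbitrarily close to \<open>1\<close>, that is, with a body arbitrarily
  close to the unit ball.

  The difficulty is to have \<open>0\<close> as center of mass.  A body of revolution whose heights increase
  from the south pole (the root) to the north pole is too heavy in the north.  Therefore the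
  southern hemisphere is raised by a factor \<open>1 + t\<close>, except along \<open>n\<close> meridians, the valleys.
  Descent survives: a raised southern facet descends along its own meridian to the south pole,
  a northern facet descends to the equator, and a facet on the equator moves sideways along the
  equator, losing height, until it meets a valley, which leads to the south pole
  (\<open>facet_has_lower_neighbour\<close>).  The valleys are repeated with period \<open>2 \<pi> / n\<close>, so the body has
  the \<open>n\<close>-fold symmetry, and this symmetry puts the center of mass on the polar axis
  (\<open>center_of_mass_rotationally_symmetric\<close>).

  Its remaining coordinate depends continuously on \<open>t\<close>
  (\<open>continuous_z_moment_valley_body\<close>).  At \<open>t = 0\<close> it is nonnegative
  (\<open>z_moment_valley_body_0_nonneg\<close>).  For a fixed \<open>t = \<eta>\<close> and a fine net it is nonpositive: if the
  heights are constant apart from the bulge, the lower half of the body contains the mirror image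
  of the upper half and in addition a ball whose size depends on \<open>\<eta>\<close> only
  (\<open>z_moment_valley_body_bulge\<close>), while the descending heights perturb such a body by a factor
  that tends to \<open>1\<close> as the net is refined.  The intermediate value theorem gives a \<open>t\<close> for which
  the center of mass is \<open>0\<close>.
\<close>

section \<open>Stable points of an intersection of half-spaces\<close>

definition halfspaces_body :: "('a::euclidean_space \<times> real) set \<Rightarrow> 'a set" where
  "halfspaces_body H = {x. \<forall>(u, b) \<in> H. u \<bullet> x \<le> b}"

lemma halfspaces_bodyD: "x \<in> halfspaces_body H \<Longrightarrow> (u, b) \<in> H \<Longrightarrow> u \<bullet> x \<le> b"
  by (auto simp: halfspaces_body_def)

lemma polyhedron_halfspaces_body:
  assumes "finite H"
  shows "polyhedron (halfspaces_body H)"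
proof -
  have "halfspaces_body H = (\<Inter>p\<in>H. {x. fst p \<bullet> x \<le> snd p})"
    by (fastforce simp: halfspaces_body_def)
  then show ?thesis
    using assms by (auto intro!: polyhedron_Inter polyhedron_halfspace_le)
qed

lemma rel_interior_max_imp_constant:
  fixes F :: "'a::euclidean_space set"
  assumes "convex F" "q \<in> rel_interior F" "\<And>x. x \<in> F \<Longrightarrow> a \<bullet> x \<le> a \<bullet> q"
  shows "F \<subseteq> {x. a \<bullet> x = a \<bullet> q}"
proof -
  have "F \<inter> {x. a \<bullet> x = a \<bullet> q} face_of F"
    using face_of_Int_supporting_hyperplane_le assms(1,3) by blast
  moreover have "q \<in> F"
    using assms(2) rel_interior_subset by blast
  ultimately have "F \<subseteq> F \<inter> {x. a \<bullet> x = a \<bullet> q}"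
    using subset_of_face_of assms(2) by blast
  then show ?thesis by blast
qed

lemma interior_halfspaces_body:
  assumes "finite H" "\<And>u b. (u, b) \<in> H \<Longrightarrow> u \<bullet> q < b"
  shows "\<exists>e>0. ball q e \<subseteq> halfspaces_body H"
proof -
  define S where "S = (\<Inter>p\<in>H. {x. fst p \<bullet> x < snd p})"
  have "open S"
    unfolding S_def using assms(1) by (auto intro!: open_INT open_halfspace_lt)
  moreover have "q \<in> S"
    using assms(2) by (auto simp: S_def)
  moreover have "S \<subseteq> halfspaces_body H"
    by (fastforce simp: S_def halfspaces_body_def)
  ultimately show ?thesis
    by (meson open_contains_ball order_trans)
qed

lemma frontier_halfspaces_body_active:
  assumes "finite H" "q \<in> frontier (halfspaces_body H)"
  obtains u b where "(u, b) \<in> H" "u \<bullet> q = b"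
proof -
  have clo: "closed (halfspaces_body H)"
    using assms(1) polyhedron_halfspaces_body polyhedron_imp_closed by blast
  then have q: "q \<in> halfspaces_body H" "q \<notin> interior (halfspaces_body H)"
    using assms(2) by (auto simp: frontier_def)
  have "\<exists>u b. (u, b) \<in> H \<and> \<not> u \<bullet> q < b"
  proof (rule ccontr)
    assume "\<not> ?thesis"
    then obtain e where "e > 0" "ball q e \<subseteq> halfspaces_body H"
      using interior_halfspaces_body[OF assms(1), of q] by blast
    then show False
      using q(2) by (meson centre_in_ball interior_maximal open_ball subsetD)
  qed
  then show ?thesis
    using that halfspaces_bodyD[OF q(1)] by fastforce
qed

text \<open>A stable point lies in the relative interior of a two-dimensional face \<open>F\<close>, and every plane that
  supports the body there contains \<open>F\<close>.  Two planes that contain \<open>F\<close> coincide, so the plane through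
  \<open>q\<close> orthogonal to \<open>q\<close> is the plane of each half-space whose boundary contains \<open>q\<close>.\<close>

lemma stable_point_imp_foot:
  fixes H :: "((real^3) \<times> real) set"
  assumes fin: "finite H" and H: "\<And>u b. (u, b) \<in> H \<Longrightarrow> norm u = 1 \<and> b > 0"
    and com: "center_of_mass (halfspaces_body H) = 0"
    and st: "stable_point (halfspaces_body H) q"
  shows "\<exists>u b. (u, b) \<in> H \<and> q = b *\<^sub>R u \<and> (\<forall>(v, d) \<in> H. d \<le> v \<bullet> q \<longrightarrow> d = b)"
proof -
  let ?P = "halfspaces_body H"
  obtain F where F: "F face_of ?P" "aff_dim F = 2" "q \<in> rel_interior F" and eq: "equilibrium_point ?P q"
    using st by (auto simp: stable_point_def)
  have cF: "convex F" and qF: "q \<in> F" and FP: "F \<subseteq> ?P"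
    using F face_of_imp_convex face_of_imp_subset rel_interior_subset by blast+
  have qfr: "q \<in> frontier ?P" and sup: "supporting_hyperplane {x. q \<bullet> (x - q) = 0} ?P"
    using eq com by (auto simp: equilibrium_point_def)
  obtain a b where ab: "a \<noteq> 0" "{x. q \<bullet> (x - q) = 0} = {x. a \<bullet> x = b}" "?P \<subseteq> {x. a \<bullet> x \<le> b}"
    using sup by (auto simp: supporting_hyperplane_def)
  have "q \<in> {x. q \<bullet> (x - q) = 0}" by simp
  then have aq: "a \<bullet> q = b" unfolding ab(2) by simp
  have q0: "q \<noteq> 0"
  proof
    assume "q = 0"
    then have "a \<in> {x. q \<bullet> (x - q) = 0}" and "b = 0" using aq by simp_all
    then have "a \<bullet> a = 0" unfolding ab(2) by simp
    then show False using ab(1) by simp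
  qed
  have Fq: "F \<subseteq> {x. q \<bullet> x = q \<bullet> q}"
  proof -
    have "F \<subseteq> {x. a \<bullet> x = a \<bullet> q}"
      using rel_interior_max_imp_constant[OF cF F(3)] FP ab(3) aq by blast
    also have "\<dots> = {x. q \<bullet> (x - q) = 0}" using ab(2) aq by simp
    finally show ?thesis by (auto simp: inner_diff_right)
  qed
  \<comment> \<open>A plane that contains the two-dimensional \<open>F\<close> is its affine hull, so all such planes agree.\<close>
  have hull: "affine hull F = {x. v \<bullet> x = d}" if "v \<noteq> 0" "F \<subseteq> {x. v \<bullet> x = d}" for v d
  proof (rule affine_dim_equal)
    show "affine hull F \<subseteq> {x. v \<bullet> x = d}"
      using that(2) by (simp add: affine_hyperplane hull_minimal)
    show "aff_dim (affine hull F) = aff_dim {x. v \<bullet> x = d}"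
      using F(2) that(1) by (simp add: aff_dim_hyperplane)
    show "affine hull F \<noteq> {}"
      using qF by auto
  qed (auto simp: affine_hyperplane)
  have active: "q = d *\<^sub>R v \<and> norm q = d" if vd: "(v, d) \<in> H" and "d \<le> v \<bullet> q" for v d
  proof -
    have vq: "v \<bullet> q = d"
      using that FP qF halfspaces_bodyD by fastforce
    have v0: "v \<noteq> 0" and nv: "v \<bullet> v = 1" and d: "d > 0"
      using H[OF vd] by (auto simp: norm_eq_1)
    have "F \<subseteq> {x. v \<bullet> x = v \<bullet> q}"
      using rel_interior_max_imp_constant[OF cF F(3)] FP halfspaces_bodyD[OF _ vd] vq by blast
    then have "{x. v \<bullet> x = v \<bullet> q} = {x. q \<bullet> x = q \<bullet> q}"
      using hull[OF v0] hull[OF q0 Fq] by blast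
    moreover have "d *\<^sub>R v \<in> {x. v \<bullet> x = v \<bullet> q}"
      using nv vq by simp
    ultimately have "q \<bullet> (d *\<^sub>R v) = q \<bullet> q"
      by blast
    then have qq: "q \<bullet> q = d * d"
      using vq by (simp add: inner_commute)
    have "(q - d *\<^sub>R v) \<bullet> (q - d *\<^sub>R v) = 0"
      using qq vq nv by (simp add: inner_diff_left inner_diff_right inner_commute)
    moreover have "norm q = d"
      using qq d by (simp add: norm_eq_sqrt_inner)
    ultimately show ?thesis by simp
  qed
  obtain u b' where "(u, b') \<in> H" "u \<bullet> q = b'"
    using frontier_halfspaces_body_active[OF fin qfr] .
  then show ?thesis
    using active by (metis (mono_tags, lifting) case_prodI2 order_refl)
qed

text \<open>Near the foot \<open>b u\<close> only the inequality of \<open>(u, b)\<close> matters, so a disc around the foot lies in the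
  body and is part of a two-dimensional face.\<close>

lemma foot_imp_stable_point:
  fixes H :: "((real^3) \<times> real) set"
  assumes fin: "finite H" and ub: "(u, b) \<in> H" "norm u = 1" "b > 0"
    and com: "center_of_mass (halfspaces_body H) = 0"
    and less: "\<And>v d. (v, d) \<in> H - {(u, b)} \<Longrightarrow> v \<bullet> (b *\<^sub>R u) < d"
  shows "stable_point (halfspaces_body H) (b *\<^sub>R u)"
proof -
  let ?P = "halfspaces_body H" and ?q = "b *\<^sub>R u" and ?H = "{x. u \<bullet> x = b}"
  define F where "F = ?P \<inter> ?H"
  have uu: "u \<bullet> u = 1" using ub by (simp add: norm_eq_1)
  obtain e where e: "e > 0" "ball ?q e \<subseteq> halfspaces_body (H - {(u, b)})"
    using interior_halfspaces_body[of "H - {(u, b)}" ?q] fin less by blast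
  have sub: "?H \<inter> ball ?q e \<subseteq> F"
    using e(2) by (auto simp: F_def halfspaces_body_def)
  have qF: "?q \<in> F"
    using sub e(1) uu by auto
  have "affine hull (?H \<inter> ball ?q e) = affine hull ?H"
  proof (rule affine_hull_affine_Int_nonempty_interior)
    show "?H \<inter> interior (ball ?q e) \<noteq> {}"
      using uu e(1) by (metis (mono_tags, lifting) IntI centre_in_ball empty_iff inner_scaleR_right
          interior_open mem_Collect_eq mult.right_neutral open_ball)
  qed (simp add: affine_hyperplane)
  then have hull: "affine hull F = ?H"
    using hull_mono[OF sub, of affine] hull_minimal[of F ?H affine] affine_hyperplane[of u b]
    by (simp add: F_def hull_same)
  have "F face_of ?P"
    unfolding F_def
    by (rule face_of_Int_supporting_hyperplane_le)
      (use fin ub halfspaces_bodyD in \<open>auto simp: polyhedron_halfspaces_body polyhedron_imp_convex\<close>)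
  moreover have "aff_dim F = 2"
  proof -
    have "u \<noteq> 0" using uu by auto
    then show ?thesis
      using aff_dim_hyperplane[of u b] hull aff_dim_affine_hull[of F] by simp
  qed
  moreover have "?q \<in> rel_interior F"
    using qF e(1) sub hull by (auto simp: mem_rel_interior_ball)
  moreover have "?q \<in> frontier ?P"
  proof -
    have "?q \<notin> interior ?P"
    proof
      assume "?q \<in> interior ?P"
      moreover have "?P \<subseteq> {x. u \<bullet> x \<le> b}" using ub(1) halfspaces_bodyD by auto
      ultimately have "?q \<in> interior {x. u \<bullet> x \<le> b}" using interior_mono by blast
      moreover have "u \<noteq> 0" using uu by auto
      ultimately show False using uu by (simp add: interior_halfspace_le)
    qed
    then show ?thesis
      using qF closure_subset by (auto simp: frontier_def F_def)
  qed
  moreover have "supporting_hyperplane {x. ?q \<bullet> (x - ?q) = 0} ?P"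
    unfolding supporting_hyperplane_def
  proof (intro exI conjI)
    show "u \<noteq> 0" using uu by auto
    show "{x. ?q \<bullet> (x - ?q) = 0} = {x. u \<bullet> x = b}"
      using ub(3) uu by (auto simp: inner_diff_right)
    show "?P \<subseteq> {x. u \<bullet> x \<le> b}" using ub(1) halfspaces_bodyD by auto
    show "{x. ?q \<bullet> (x - ?q) = 0} \<inter> ?P \<noteq> {}"
      using qF by (intro notI) (auto simp: F_def disjoint_iff)
  qed
  ultimately show ?thesis
    unfolding stable_point_def equilibrium_point_def com by auto
qed

text \<open>The hypothesis on descent says that the foot of every facet but the root violates, or turns into an
  equality, the inequality of a lower facet; by \<open>stable_point_imp_foot\<close> it is then not stable.
  The strict comparison \<open>d < b\<close> prevents a facet from descending to itself.\<close>

lemma monostable_if_descending: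
  fixes H :: "((real^3) \<times> real) set"
  assumes fin: "finite H" and H: "\<And>u b. (u, b) \<in> H \<Longrightarrow> norm u = 1 \<and> b > 0"
    and com: "center_of_mass (halfspaces_body H) = 0"
    and root: "(r, c) \<in> H"
    and min: "\<And>u b. (u, b) \<in> H - {(r, c)} \<Longrightarrow> c < b"
    and desc: "\<And>u b. (u, b) \<in> H - {(r, c)} \<Longrightarrow> \<exists>(v, d) \<in> H. d < b \<and> d \<le> b * (v \<bullet> u)"
  shows "monostable (halfspaces_body H)"
  unfolding monostable_def
proof
  show "stable_point (halfspaces_body H) (c *\<^sub>R r)"
  proof (rule foot_imp_stable_point[OF fin root _ _ com])
    fix v d assume vd: "(v, d) \<in> H - {(r, c)}"
    have "v \<bullet> r \<le> 1"
      using H[of v d] H[OF root] vd norm_cauchy_schwarz[of v r] by auto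
    then have "v \<bullet> (c *\<^sub>R r) \<le> c"
      using H[OF root] by (simp add: mult_left_le)
    then show "v \<bullet> (c *\<^sub>R r) < d"
      using min[OF vd] by linarith
  qed (use H[OF root] in auto)
next
  fix q assume "stable_point (halfspaces_body H) q"
  then obtain u b where ub: "(u, b) \<in> H" "q = b *\<^sub>R u"
    and act: "\<And>v d. (v, d) \<in> H \<Longrightarrow> d \<le> v \<bullet> q \<Longrightarrow> d = b"
    using stable_point_imp_foot[OF fin H com] by (fastforce split: prod.splits)
  have "(u, b) = (r, c)"
  proof (rule ccontr)
    assume "(u, b) \<noteq> (r, c)"
    then obtain v d where "(v, d) \<in> H" "d < b" "d \<le> b * (v \<bullet> u)"
      using desc[of u b] ub(1) by blast
    then show False using act[of v d] ub(2) by auto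
  qed
  then show "q = c *\<^sub>R r" using ub(2) by simp
qed

section \<open>First moments of compact sets\<close>

lemma compact_set_integrable:
  fixes f :: "'a::euclidean_space \<Rightarrow> 'b::euclidean_space"
  assumes "compact S" "continuous_on S f"
  shows "f absolutely_integrable_on S"
  using borel_integrable_compact[OF assms] unfolding set_integrable_def
  by (simp add: integrable_completion borel_measurable_integrable)

lemma compact_integrable_on:
  fixes f :: "'a::euclidean_space \<Rightarrow> 'b::euclidean_space"
  assumes "compact S" "continuous_on S f"
  shows "f integrable_on S"
  using compact_set_integrable[OF assms] set_lebesgue_integral_eq_integral(1) by blast

lemma center_of_mass_eq_0I:
  fixes P :: "'a::euclidean_space set"
  assumes "compact P" "integral P (\<lambda>x. x) = 0"
  shows "center_of_mass P = 0"
  using set_lebesgue_integral_eq_integral(2)[OF compact_set_integrable[OF assms(1), of "\<lambda>x. x"]] assms(2)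
  by (simp add: center_of_mass_def)

lemma integral_orthogonal_image:
  fixes T :: "real^'n::{finite,wellorder} \<Rightarrow> real^'n::_"
  assumes "orthogonal_transformation T" "compact P"
  shows "integral (T ` P) (\<lambda>x. x) = T (integral P (\<lambda>x. x))"
proof -
  have lin: "linear T"
    using assms(1) by (rule orthogonal_transformation_linear)
  have cont: "continuous_on S T" for S
    using lin by (rule linear_continuous_on[OF linear_conv_bounded_linear[THEN iffD1]])
  have int: "(\<lambda>x. x) integrable_on P"
    by (rule compact_integrable_on) (use assms in auto)
  have "integral (T ` P) (\<lambda>x. x) = \<bar>det (matrix T)\<bar> *\<^sub>R integral P ((\<lambda>x. x) \<circ> T)"
    by (rule integral_change_of_variables_linear[OF lin])
      (use assms(2) cont compact_set_integrable in \<open>auto simp: o_def\<close>)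
  also have "\<bar>det (matrix T)\<bar> = 1"
    using assms(1) by (simp add: orthogonal_transformation_det)
  also have "integral P ((\<lambda>x. x) \<circ> T) = T (integral P (\<lambda>x. x))"
    using integral_linear[OF int, of T] lin by (simp add: o_def linear_conv_bounded_linear)
  finally show ?thesis by simp
qed

definition z_moment :: "(real^3) set \<Rightarrow> real" where
  "z_moment P = integral P (\<lambda>x. x $ 3)"

lemma z_moment_eq: "compact P \<Longrightarrow> z_moment P = integral P (\<lambda>x. x) $ 3"
  unfolding z_moment_def
  by (rule integral_component_eq_cart) (rule compact_integrable_on; simp)

lemma z_integrable: "compact P \<Longrightarrow> (\<lambda>x::real^3. x $ 3) integrable_on P"
  by (rule compact_integrable_on) (auto intro!: continuous_intros)

definition mirror :: "real^3 \<Rightarrow> real^3" where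
  "mirror x = vector [x $ 1, x $ 2, - x $ 3]"

lemma mirror_nth [simp]: "mirror x $ 1 = x $ 1" "mirror x $ 2 = x $ 2" "mirror x $ 3 = - x $ 3"
  by (simp_all add: mirror_def)

lemma mirror_mirror [simp]: "mirror (mirror x) = x"
  by (simp add: vec_eq_iff forall_3)

lemma inner_3: "(x::real^3) \<bullet> y = x$1 * y$1 + x$2 * y$2 + x$3 * y$3"
  by (simp add: inner_vec_def sum_3)

lemma orthogonal_mirror: "orthogonal_transformation mirror"
  unfolding orthogonal_transformation_def
  by (auto simp: inner_3 linear_iff vec_eq_iff forall_3)

lemma compact_mirror: "compact P \<Longrightarrow> compact (mirror ` P)"
  using orthogonal_mirror
  by (intro compact_continuous_image linear_continuous_on)
    (auto simp: orthogonal_transformation_linear linear_conv_bounded_linear[symmetric])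

lemma z_moment_mirror:
  assumes "compact P"
  shows "z_moment (mirror ` P) = - z_moment P"
  using integral_orthogonal_image[OF orthogonal_mirror assms] compact_mirror[OF assms] assms
  by (simp add: z_moment_eq)

text \<open>Points above the plane \<open>z = 0\<close> that are added to \<open>A\<close>, and points below it that are removed, can only
  increase the moment; removing \<open>W\<close> increases it by at least \<open>g\<close> times the volume of \<open>W\<close>.  It serves to
  compare a set with its own mirror image, whose moment is the negative one.\<close>

lemma z_moment_mono_gain:
  assumes "compact A" "compact B" "compact W" "W \<subseteq> A" "W \<inter> B = {}"
    and W: "\<And>x. x \<in> W \<Longrightarrow> x $ 3 \<le> - g"
    and up: "\<And>x. x \<in> A \<Longrightarrow> x $ 3 > 0 \<Longrightarrow> x \<in> B"
    and low: "\<And>x. x \<in> B \<Longrightarrow> x $ 3 < 0 \<Longrightarrow> x \<in> A"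
  shows "z_moment A + g * measure lebesgue W \<le> z_moment B"
proof -
  define z where "z S x = (if x \<in> S then x $ 3 else 0)" for S and x :: "real^3"
  define w where "w x = (if x \<in> W then g else 0)" for x
  have zi: "z S integrable_on UNIV" "integral UNIV (z S) = z_moment S" if "compact S" for S
    using z_integrable[OF that]
    by (auto simp: z_def[abs_def] z_moment_def integral_restrict_UNIV integrable_restrict_UNIV)
  have "W \<in> lmeasurable"
    using assms(3) by (rule lmeasurable_compact)
  then have wi: "w integrable_on UNIV" "integral UNIV w = g * measure lebesgue W"
    using integral_mult_right[of W g "\<lambda>_. 1::real"]
    by (auto simp: w_def[abs_def] integral_restrict_UNIV integrable_restrict_UNIV
        integrable_on_const lmeasure_integral)
  have "integral UNIV (\<lambda>x. z A x + w x) \<le> integral UNIV (z B)"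
  proof (rule integral_le)
    show "z A x + w x \<le> z B x" for x
      using W[of x] up[of x] low[of x] assms(4,5) by (fastforce simp: z_def w_def)
  qed (use zi wi assms in \<open>auto intro: integrable_add\<close>)
  then show ?thesis
    using zi wi assms by (simp add: integral_add)
qed

corollary z_moment_mono:
  assumes "compact A" "compact B"
    and "\<And>x. x \<in> A \<Longrightarrow> x $ 3 > 0 \<Longrightarrow> x \<in> B" "\<And>x. x \<in> B \<Longrightarrow> x $ 3 < 0 \<Longrightarrow> x \<in> A"
  shows "z_moment A \<le> z_moment B"
  using z_moment_mono_gain[of A B "{}" 0] assms by simp

text \<open>If \<open>P\<close> lies between \<open>Q\<close> and \<open>c Q\<close>, then the volume of \<open>P - Q\<close> is at most \<open>c\<^sup>3 - 1\<close> times that of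
  \<open>Q\<close>.  This one estimate yields both the continuity of the moment in the height of the bulge and
  the comparison with constant heights.\<close>

lemma z_moment_squeezed:
  assumes "compact P" "compact Q" "Q \<subseteq> P" "P \<subseteq> (*\<^sub>R) c ` Q" "c \<ge> 1"
    and R: "\<And>x. x \<in> P \<Longrightarrow> \<bar>x $ 3\<bar> \<le> R"
  shows "\<bar>z_moment P - z_moment Q\<bar> \<le> R * ((c ^ 3 - 1) * measure lebesgue Q)"
proof (cases "P = {}")
  case True
  then show ?thesis using assms by simp
next
  case False
  then have R0: "R \<ge> 0" using R by fastforce
  define z where "z x = (if x \<in> P then x $ 3 else 0) - (if x \<in> Q then x $ 3 else 0)" for x :: "real^3"
  define w where "w x = (if x \<in> P then R else 0) - (if x \<in> Q then R else 0)" for x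
  have meas: "P \<in> lmeasurable" "Q \<in> lmeasurable" "(*\<^sub>R) c ` Q \<in> lmeasurable"
    using assms(1,2) by (auto intro: lmeasurable_compact compact_scaling)
  have zi: "z integrable_on UNIV" "integral UNIV z = z_moment P - z_moment Q"
    using z_integrable[OF assms(1)] z_integrable[OF assms(2)] unfolding z_def[abs_def] z_moment_def
    by (auto simp: integral_diff integral_restrict_UNIV integrable_restrict_UNIV intro!: integrable_diff)
  have wi: "w integrable_on UNIV" "integral UNIV w = R * measure lebesgue P - R * measure lebesgue Q"
    using meas integral_mult_right[of P R "\<lambda>_. 1::real"] integral_mult_right[of Q R "\<lambda>_. 1::real"]
    unfolding w_def[abs_def]
    by (auto simp: integral_diff integral_restrict_UNIV integrable_restrict_UNIV integrable_on_const
        lmeasure_integral intro!: integrable_diff)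
  have "norm (integral UNIV z) \<le> integral UNIV w"
  proof (rule integral_norm_bound_integral[OF zi(1) wi(1)])
    show "norm (z x) \<le> w x" for x
      using R[of x] assms(3) R0 by (auto simp: z_def w_def)
  qed
  also have "\<dots> = R * (measure lebesgue P - measure lebesgue Q)"
    by (simp add: wi(2) algebra_simps)
  also have "\<dots> \<le> R * ((c ^ 3 - 1) * measure lebesgue Q)"
  proof (rule mult_left_mono[OF _ R0])
    have "measure lebesgue P \<le> measure lebesgue ((*\<^sub>R) c ` Q)"
      using assms(4) meas by (intro measure_mono_fmeasurable) auto
    also have "\<dots> = c ^ 3 * measure lebesgue Q"
      using measure_lebesgue_affine[of c 0 Q] assms(5) by simp
    finally show "measure lebesgue P - measure lebesgue Q \<le> (c ^ 3 - 1) * measure lebesgue Q"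
      by (simp add: algebra_simps)
  qed
  finally show ?thesis by (simp add: zi(2))
qed

lemma orthogonal_rotation_axis3: "orthogonal_transformation (rotation_about 0 (axis 3 1) t)"
proof -
  have "rotation_about 0 (axis 3 1) t x \<bullet> rotation_about 0 (axis 3 1) t y = x \<bullet> y" for x y
    using sin_cos_squared_add[of t]
    by (simp add: rotation_about_third_axis inner_3 power2_eq_square) algebra
  moreover have "linear (rotation_about 0 (axis 3 1) t)"
    by (auto simp: linear_iff rotation_about_third_axis vec_eq_iff forall_3 algebra_simps)
  ultimately show ?thesis
    by (simp add: orthogonal_transformation_def)
qed

text \<open>The integral of the identity is a vector fixed by the rotation, hence parallel to the axis.\<close>

lemma center_of_mass_rotationally_symmetric:
  assumes "compact P" "rotation_about 0 (axis 3 1) t ` P = P" "cos t \<noteq> 1" "z_moment P = 0"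
  shows "center_of_mass P = 0"
proof (rule center_of_mass_eq_0I[OF assms(1)])
  define v where "v = integral P (\<lambda>x. x)"
  define c where "c = cos t"
  define s where "s = sin t"
  have cs: "c^2 + s^2 = 1" "c \<noteq> 1" using assms(3) by (auto simp: c_def s_def)
  have "rotation_about 0 (axis 3 1) t v = v"
    using integral_orthogonal_image[OF orthogonal_rotation_axis3 assms(1), of t] assms(2)
    by (simp add: v_def)
  then have e: "c * v$1 - s * v$2 = v$1" "s * v$1 + c * v$2 = v$2"
    by (auto simp: rotation_about_third_axis c_def s_def vec_eq_iff forall_3)
  \<comment> \<open>This linear system in \<open>v$1\<close>, \<open>v$2\<close> has determinant \<open>(c - 1)\<^sup>2 + s\<^sup>2\<close>.\<close>
  have pos: "(c - 1)\<^sup>2 + s\<^sup>2 \<noteq> 0"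
    using cs by (simp add: sum_power2_eq_zero_iff)
  have "((c - 1)\<^sup>2 + s\<^sup>2) * v$1 = (c - 1) * (c * v$1 - s * v$2 - v$1) + s * (s * v$1 + c * v$2 - v$2)"
    by (simp add: algebra_simps power2_eq_square)
  moreover have "((c - 1)\<^sup>2 + s\<^sup>2) * v$2 = (c - 1) * (s * v$1 + c * v$2 - v$2) - s * (c * v$1 - s * v$2 - v$1)"
    by (simp add: algebra_simps power2_eq_square)
  ultimately have "v$1 = 0" "v$2 = 0"
    using e pos by auto
  moreover have "v$3 = 0"
    using assms(1,4) z_moment_eq by (simp add: v_def)
  ultimately show "integral P (\<lambda>x. x) = 0"
    by (simp add: v_def[symmetric] vec_eq_iff forall_3)
qed

section \<open>A net of directions\<close>

text \<open>The polar angle \<open>\<theta>\<close> is measured from the south pole because all descending paths will end there.\<close>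

definition sph :: "real \<Rightarrow> real \<Rightarrow> real^3" where
  "sph \<theta> \<phi> = vector [sin \<theta> * cos \<phi>, sin \<theta> * sin \<phi>, - cos \<theta>]"

lemma sph_nth [simp]:
  "sph \<theta> \<phi> $ 1 = sin \<theta> * cos \<phi>" "sph \<theta> \<phi> $ 2 = sin \<theta> * sin \<phi>" "sph \<theta> \<phi> $ 3 = - cos \<theta>"
  by (simp_all add: sph_def)

lemma inner_sph: "sph \<theta> \<phi> \<bullet> sph \<theta>' \<phi>' = sin \<theta> * sin \<theta>' * cos (\<phi> - \<phi>') + cos \<theta> * cos \<theta>'"
  by (simp add: inner_3 cos_diff algebra_simps)

lemma norm_sph [simp]: "norm (sph \<theta> \<phi>) = 1"
  by (simp add: norm_eq_1 inner_sph power2_eq_square[symmetric])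

lemma sph_coordinates:
  fixes w :: "real^3"
  obtains \<theta> \<phi> where "0 \<le> \<theta>" "\<theta> \<le> pi" "0 \<le> \<phi>" "\<phi> < 2 * pi" "w = norm w *\<^sub>R sph \<theta> \<phi>"
proof (cases "w = 0")
  case True
  then show ?thesis using that[of 0 0] by simp
next
  case False
  define v where "v = w /\<^sub>R norm w"
  define \<theta> where "\<theta> = arccos (- v $ 3)"
  have v: "v$1 * v$1 + v$2 * v$2 + v$3 * v$3 = 1"
    unfolding inner_3[symmetric] norm_eq_1[symmetric] using False by (simp add: v_def)
  then have "(v$3)\<^sup>2 \<le> 1"
    unfolding power2_eq_square using zero_le_square[of "v$1"] zero_le_square[of "v$2"] by linarith
  then have v3: "- 1 \<le> v$3" "v$3 \<le> 1"
    unfolding abs_square_le_1 by linarith+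
  have \<theta>: "0 \<le> \<theta>" "\<theta> \<le> pi" "cos \<theta> = - v$3"
    using v3 by (auto simp: \<theta>_def arccos_lbound arccos_ubound)
  have s: "(sin \<theta>)\<^sup>2 = (v$1)\<^sup>2 + (v$2)\<^sup>2"
    using v \<theta>(3) sin_cos_squared_add[of \<theta>] by (simp add: power2_eq_square)
  have "\<exists>\<phi>\<ge>0. \<phi> < 2 * pi \<and> v$1 = sin \<theta> * cos \<phi> \<and> v$2 = sin \<theta> * sin \<phi>"
  proof (cases "sin \<theta> = 0")
    case True
    then have "v$1 = 0" "v$2 = 0" using s by (auto simp: sum_power2_eq_zero_iff)
    then show ?thesis using True by (intro exI[of _ 0]) auto
  next
    case False
    have "(v$1 / sin \<theta>)\<^sup>2 + (v$2 / sin \<theta>)\<^sup>2 = 1"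
      unfolding power_divide add_divide_distrib[symmetric] s[symmetric] using False by simp
    then obtain t where "0 \<le> t" "t < 2 * pi" "v$1 / sin \<theta> = cos t" "v$2 / sin \<theta> = sin t"
      using sincos_total_2pi by metis
    then show ?thesis using False by (intro exI[of _ t]) (auto simp: field_simps)
  qed
  then obtain \<phi> where "\<phi> \<ge> 0" "\<phi> < 2 * pi" "v = sph \<theta> \<phi>"
    using \<theta>(3) by (auto simp: vec_eq_iff forall_3)
  moreover have "w = norm w *\<^sub>R v"
    using False by (simp add: v_def)
  ultimately show ?thesis
    using that \<theta> by metis
qed

lemma cos_ge_quadratic: "cos x \<ge> 1 - x\<^sup>2 / 2" for x :: real
proof -
  have "\<bar>sin (x / 2)\<bar> \<le> \<bar>x / 2\<bar>" by (rule abs_sin_x_le_abs_x)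
  then have "(sin (x / 2))\<^sup>2 \<le> (x / 2)\<^sup>2" by (simp only: abs_le_square_iff)
  then show ?thesis
    using cos_double_sin[of "x / 2"] by (simp add: power_divide)
qed

lemma inner_sph_ge:
  assumes "0 \<le> \<theta>" "\<theta> \<le> pi" "0 \<le> \<theta>'" "\<theta>' \<le> pi"
  shows "sph \<theta> \<phi> \<bullet> sph \<theta>' \<phi>' \<ge> 1 - (\<theta> - \<theta>')\<^sup>2 / 2 - (\<phi> - \<phi>')\<^sup>2 / 2"
proof -
  have "sin \<theta> * sin \<theta>' * (1 - cos (\<phi> - \<phi>')) \<le> 1 * (1 - cos (\<phi> - \<phi>'))"
    using assms by (intro mult_right_mono) (auto intro: mult_le_one sin_ge_zero)
  then have "sph \<theta> \<phi> \<bullet> sph \<theta>' \<phi>' \<ge> cos (\<theta> - \<theta>') - (1 - cos (\<phi> - \<phi>'))"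
    by (simp add: inner_sph cos_diff[of \<theta>] algebra_simps)
  then show ?thesis
    using cos_ge_quadratic[of "\<theta> - \<theta>'"] cos_ge_quadratic[of "\<phi> - \<phi>'"] by linarith
qed

text \<open>The net has \<open>2 L + 1\<close> parallels, with the poles at \<open>j = 0\<close> and \<open>j = 2 L\<close> and the equator at
  \<open>j = L\<close>, and \<open>2 L n\<close> meridians.  The index \<open>k\<close> of a meridian runs through all natural numbers,
  which makes the rotation by \<open>2 \<pi> / n\<close> the shift of \<open>k\<close> by \<open>2 L\<close>, without reduction modulo \<open>2 L n\<close>.\<close>

definition dir :: "nat \<Rightarrow> nat \<Rightarrow> nat \<Rightarrow> nat \<Rightarrow> real^3" where
  "dir n L j k = sph (pi * real j / (2 * real L)) (pi * real k / (real L * real n))"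

lemma norm_dir [simp]: "norm (dir n L j k) = 1"
  by (simp add: dir_def)

lemma latitude_range:
  assumes "j \<le> 2 * L"
  shows "0 \<le> pi * real j / (2 * real L)" "pi * real j / (2 * real L) \<le> pi"
proof -
  have "real j \<le> 2 * real L" using assms by linarith
  then show "pi * real j / (2 * real L) \<le> pi"
    by (cases "L = 0") (auto simp: divide_le_eq)
qed simp

lemma dir_periodic: "n \<ge> 1 \<Longrightarrow> L \<ge> 1 \<Longrightarrow> dir n L j (k + 2 * L * n) = dir n L j k"
proof -
  assume "n \<ge> 1" "L \<ge> 1"
  then have "pi * real (k + 2 * L * n) / (real L * real n) = pi * real k / (real L * real n) + 2 * pi"
    by (simp add: field_simps)
  then show ?thesis by (simp add: dir_def vec_eq_iff forall_3)
qed

text \<open>This is a lower bound for the cosine of the angle between any nonzero vector and a nearest direction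
  of the net, for \<open>L \<ge> 2\<close>.  The true bound is \<open>1 - O(1/L\<^sup>2)\<close>; the weaker form with \<open>L\<close> in the denominator also bounds the
  total descent in \<open>step_ratio_power_le\<close>, so that one quantity controls both errors.\<close>

definition cos_mesh :: "nat \<Rightarrow> real" where
  "cos_mesh L = 1 - pi\<^sup>2 / (2 * real L)"

text \<open>Both coordinates are rounded down to the grid.  Rounding down does not leave the closed northern
  hemisphere because the equator is one of the parallels.\<close>

lemma dir_net:
  fixes w :: "real^3"
  assumes "L \<ge> 2" "n \<ge> 1"
  obtains j k where "j \<le> 2 * L" "w $ 3 \<ge> 0 \<Longrightarrow> w \<noteq> 0 \<Longrightarrow> L \<le> j"
    "dir n L j k \<bullet> w \<ge> cos_mesh L * norm w"
proof -
  obtain \<theta> \<phi> where \<theta>: "0 \<le> \<theta>" "\<theta> \<le> pi" and \<phi>: "0 \<le> \<phi>" "\<phi> < 2 * pi"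
    and w: "w = norm w *\<^sub>R sph \<theta> \<phi>"
    using sph_coordinates .
  define j where "j = nat \<lfloor>\<theta> * (2 * L) / pi\<rfloor>"
  define k where "k = nat \<lfloor>\<phi> * (L * n) / pi\<rfloor>"
  have L: "real L \<ge> 2" and n: "real n \<ge> 1" using assms by auto
  have j: "real j \<le> \<theta> * (2 * L) / pi" "\<theta> * (2 * L) / pi < real j + 1"
  proof -
    have "\<theta> * (2 * L) / pi \<ge> 0" using \<theta> by simp
    then show "real j \<le> \<theta> * (2 * L) / pi" "\<theta> * (2 * L) / pi < real j + 1"
      unfolding j_def by linarith+
  qed
  have k: "real k \<le> \<phi> * (L * n) / pi" "\<phi> * (L * n) / pi < real k + 1"
  proof -
    have "\<phi> * (L * n) / pi \<ge> 0" using \<phi> by simp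
    then show "real k \<le> \<phi> * (L * n) / pi" "\<phi> * (L * n) / pi < real k + 1"
      unfolding k_def by linarith+
  qed
  have "\<theta> * (2 * L) / pi \<le> 2 * L"
    using \<theta> mult_right_mono[of \<theta> pi "2 * L"] by (simp add: divide_le_eq mult.commute)
  then have jL: "j \<le> 2 * L" using j by linarith
  have d\<theta>: "0 \<le> \<theta> - pi * real j / (2 * L)" "\<theta> - pi * real j / (2 * L) \<le> pi / (2 * L)"
  proof -
    have "\<theta> = \<theta> * (2 * L) / pi * (pi / (2 * L))" using L by simp
    moreover have "real j * (pi / (2 * L)) \<le> \<theta> * (2 * L) / pi * (pi / (2 * L))"
      "\<theta> * (2 * L) / pi * (pi / (2 * L)) \<le> (real j + 1) * (pi / (2 * L))"
      using j L by (intro mult_right_mono; simp)+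
    ultimately show "0 \<le> \<theta> - pi * real j / (2 * L)" "\<theta> - pi * real j / (2 * L) \<le> pi / (2 * L)"
      by (simp_all add: algebra_simps add_divide_distrib)
  qed
  have d\<phi>: "0 \<le> \<phi> - pi * real k / (L * n)" "\<phi> - pi * real k / (L * n) \<le> pi / (L * n)"
  proof -
    have "\<phi> = \<phi> * (L * n) / pi * (pi / (L * n))" using L n by simp
    moreover have "real k * (pi / (L * n)) \<le> \<phi> * (L * n) / pi * (pi / (L * n))"
      "\<phi> * (L * n) / pi * (pi / (L * n)) \<le> (real k + 1) * (pi / (L * n))"
      using k L by (intro mult_right_mono; simp)+
    ultimately show "0 \<le> \<phi> - pi * real k / (L * n)" "\<phi> - pi * real k / (L * n) \<le> pi / (L * n)"
      by (simp_all add: algebra_simps add_divide_distrib)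
  qed
  have "pi / (L * n) \<le> pi / L"
    using L n by (intro divide_left_mono) (auto simp: mult_ge1_I)
  then have "(\<phi> - pi * real k / (L * n))\<^sup>2 \<le> (pi / L)\<^sup>2"
    using d\<phi> by (intro power_mono) auto
  moreover have "(\<theta> - pi * real j / (2 * L))\<^sup>2 \<le> (pi / (2 * L))\<^sup>2"
    using d\<theta> by (intro power_mono) auto
  ultimately have "(\<theta> - pi * real j / (2 * L))\<^sup>2 / 2 + (\<phi> - pi * real k / (L * n))\<^sup>2 / 2
      \<le> (pi / (2 * L))\<^sup>2 / 2 + (pi / L)\<^sup>2 / 2"
    by linarith
  also have "\<dots> = pi\<^sup>2 * (5 / 4) / (2 * L) / L"
    using L by (simp add: field_simps power2_eq_square)
  also have "\<dots> \<le> pi\<^sup>2 * L / (2 * L) / L"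
    using L by (intro divide_right_mono mult_left_mono) auto
  also have "\<dots> = pi\<^sup>2 / (2 * L)"
    using L by simp
  finally have "dir n L j k \<bullet> sph \<theta> \<phi> \<ge> cos_mesh L"
    using inner_sph_ge[OF latitude_range[OF jL] \<theta>, of "pi * real k / (L * n)" \<phi>]
    by (simp add: dir_def cos_mesh_def power2_commute)
  then have "dir n L j k \<bullet> w \<ge> cos_mesh L * norm w"
    using arg_cong[OF w, of "\<lambda>x. dir n L j k \<bullet> x"]
    unfolding inner_scaleR_right by (metis mult.commute mult_left_mono norm_ge_zero)
  moreover have "L \<le> j" if "w $ 3 \<ge> 0" "w \<noteq> 0"
  proof -
    have "w $ 3 = - norm w * cos \<theta>"
      using arg_cong[OF w, of "\<lambda>x. x $ 3"] by simp
    then have "cos \<theta> \<le> 0"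
      using that by (metis mult_minus_left neg_0_le_iff_le mult_pos_pos not_le zero_less_norm_iff)
    then have "\<theta> \<ge> pi / 2"
      using cos_gt_zero[of \<theta>] \<theta> by (cases "\<theta> = 0") fastforce+
    then have "\<theta> * (2 * L) / pi \<ge> L"
      using L by (simp add: field_simps)
    then show ?thesis by (simp add: j_def le_nat_floor)
  qed
  ultimately show ?thesis using that jL by blast
qed

section \<open>Bodies circumscribed to the net\<close>

definition net_facets :: "nat \<Rightarrow> nat \<Rightarrow> (nat \<Rightarrow> nat \<Rightarrow> real) \<Rightarrow> ((real^3) \<times> real) set" where
  "net_facets n L h = {(dir n L j k, h j k) | j k. j \<le> 2 * L}"

definition net_body :: "nat \<Rightarrow> nat \<Rightarrow> (nat \<Rightarrow> nat \<Rightarrow> real) \<Rightarrow> (real^3) set" where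
  "net_body n L h = halfspaces_body (net_facets n L h)"

lemma mem_net_body: "x \<in> net_body n L h \<longleftrightarrow> (\<forall>j k. j \<le> 2 * L \<longrightarrow> dir n L j k \<bullet> x \<le> h j k)"
  by (auto simp: net_body_def net_facets_def halfspaces_body_def)

lemma net_bodyD: "x \<in> net_body n L h \<Longrightarrow> j \<le> 2 * L \<Longrightarrow> dir n L j k \<bullet> x \<le> h j k"
  by (simp add: mem_net_body)

lemma nat_periodic_mult:
  fixes f :: "nat \<Rightarrow> 'a"
  assumes "\<And>k. f (k + p) = f k"
  shows "f (k + p * m) = f k"
proof (induction m)
  case (Suc m)
  have "f (k + p * Suc m) = f ((k + p * m) + p)"
    by (simp add: ac_simps)
  then show ?case using Suc assms by simp
qed simp

lemma finite_net_facets: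
  assumes "n \<ge> 1" "L \<ge> 1" and per: "\<And>j k. h j (k + 2 * L) = h j k"
  shows "finite (net_facets n L h)"
proof -
  let ?N = "2 * L * n"
  have red: "(dir n L j k, h j k) = (dir n L j (k mod ?N), h j (k mod ?N))" for j k
    using nat_periodic_mult[where f = "dir n L j", of ?N "k mod ?N" "k div ?N"]
      nat_periodic_mult[where f = "h j", of "2 * L" "k mod ?N" "n * (k div ?N)"]
    by (simp add: mult.assoc[symmetric] dir_periodic[OF assms(1,2)] per)
  have "net_facets n L h \<subseteq> (\<lambda>(j, k). (dir n L j k, h j k)) ` ({..2 * L} \<times> {..<?N})"
  proof
    fix p assume "p \<in> net_facets n L h"
    then obtain j k where "j \<le> 2 * L" "p = (dir n L j k, h j k)"
      by (auto simp: net_facets_def)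
    then have "p = (\<lambda>(j, k). (dir n L j k, h j k)) (j, k mod ?N)" "(j, k mod ?N) \<in> {..2 * L} \<times> {..<?N}"
      using red assms(1,2) by auto
    then show "p \<in> (\<lambda>(j, k). (dir n L j k, h j k)) ` ({..2 * L} \<times> {..<?N})" by blast
  qed
  then show ?thesis by (rule finite_subset) auto
qed

lemma rotation_about_inverse:
  "rotation_about 0 (axis 3 1) t (rotation_about 0 (axis 3 1) (- t) x) = x"
proof -
  have "(sin t)\<^sup>2 + (cos t)\<^sup>2 = 1" by simp
  then show ?thesis
    by (simp add: rotation_about_third_axis vec_eq_iff forall_3 power2_eq_square) algebra
qed

lemma sph_rotation: "sph \<theta> \<phi> \<bullet> rotation_about 0 (axis 3 1) t x = sph \<theta> (\<phi> - t) \<bullet> x"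
  by (simp add: inner_3 rotation_about_third_axis cos_diff sin_diff algebra_simps)

lemma dir_rotation:
  assumes "n \<ge> 1" "L \<ge> 1"
  shows "dir n L j (k + 2 * L) \<bullet> rotation_about 0 (axis 3 1) (2 * pi / n) x = dir n L j k \<bullet> x"
proof -
  have "pi * real (k + 2 * L) / (L * n) - 2 * pi / n = pi * real k / (L * n)"
    using assms by (simp add: field_simps)
  then show ?thesis by (simp add: dir_def sph_rotation)
qed

lemma net_body_rotation:
  assumes "n \<ge> 1" "L \<ge> 1" and per: "\<And>j k. h j (k + 2 * L) = h j k"
  shows "rotation_about 0 (axis 3 1) (2 * pi / n) ` net_body n L h = net_body n L h"
proof -
  let ?R = "rotation_about 0 (axis 3 1)" and ?t = "2 * pi / n"
  have "?R ?t x \<in> net_body n L h" if x: "x \<in> net_body n L h" for x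
    unfolding mem_net_body
  proof (intro allI impI)
    fix j k assume j: "j \<le> 2 * L"
    define k' where "k' = k + 2 * L * (n - 1)"
    have "2 * L * (n - 1) + 2 * L = 2 * L * n"
      using assms(1) by (cases n) auto
    then have k': "k' + 2 * L = k + 2 * L * n"
      by (simp add: k'_def)
    have "dir n L j k \<bullet> ?R ?t x = dir n L j k' \<bullet> x"
      using dir_rotation[OF assms(1,2), of j k' x] dir_periodic[OF assms(1,2), of j k] k' by simp
    also have "\<dots> \<le> h j k'"
      using x j by (simp add: mem_net_body)
    finally show "dir n L j k \<bullet> ?R ?t x \<le> h j k"
      using nat_periodic_mult[where f = "h j", OF per] by (simp add: k'_def)
  qed
  moreover have "?R (- ?t) x \<in> net_body n L h" if x: "x \<in> net_body n L h" for x
    unfolding mem_net_body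
  proof (intro allI impI)
    fix j k assume j: "j \<le> 2 * L"
    have "dir n L j k \<bullet> ?R (- ?t) x = dir n L j (k + 2 * L) \<bullet> x"
      using dir_rotation[OF assms(1,2), of j k "?R (- ?t) x"] by (simp add: rotation_about_inverse)
    also have "\<dots> \<le> h j (k + 2 * L)"
      using x j by (simp add: mem_net_body)
    finally show "dir n L j k \<bullet> ?R (- ?t) x \<le> h j k"
      by (simp add: per)
  qed
  ultimately show ?thesis
    by (auto simp: image_iff) (metis rotation_about_inverse)
qed

lemma cball_subset_net_body:
  assumes "\<And>j k. h j k \<ge> 1"
  shows "cball 0 1 \<subseteq> net_body n L h"
proof
  fix x :: "real^3" assume "x \<in> cball 0 1"
  then have "dir n L j k \<bullet> x \<le> 1" for j k
    using norm_cauchy_schwarz[of "dir n L j k" x] by simp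
  then show "x \<in> net_body n L h"
    using assms unfolding mem_net_body by (meson order_trans)
qed

lemma net_body_subset_cball:
  assumes "L \<ge> 2" "n \<ge> 1" and r: "cos_mesh L > 0" and h: "\<And>j k. j \<le> 2 * L \<Longrightarrow> h j k \<le> M"
  shows "net_body n L h \<subseteq> cball 0 (M / cos_mesh L)"
proof
  fix x assume x: "x \<in> net_body n L h"
  obtain j k where "j \<le> 2 * L" "dir n L j k \<bullet> x \<ge> cos_mesh L * norm x"
    using dir_net[OF assms(1,2)] by blast
  then have "cos_mesh L * norm x \<le> M"
    using net_bodyD[OF x, of j k] h[of j k] by linarith
  then show "x \<in> cball 0 (M / cos_mesh L)"
    using r by (simp add: field_simps)
qed

lemma net_body_mono:
  assumes "\<And>j k. j \<le> 2 * L \<Longrightarrow> h j k \<le> h' j k"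
  shows "net_body n L h \<subseteq> net_body n L h'"
proof
  fix x assume "x \<in> net_body n L h"
  then show "x \<in> net_body n L h'"
    using assms unfolding mem_net_body by (meson order_trans)
qed

lemma net_body_scaled:
  assumes "c > 0" "\<And>j k. j \<le> 2 * L \<Longrightarrow> h' j k \<le> c * h j k"
  shows "net_body n L h' \<subseteq> (*\<^sub>R) c ` net_body n L h"
proof
  fix x assume x: "x \<in> net_body n L h'"
  have "x /\<^sub>R c \<in> net_body n L h"
    unfolding mem_net_body
  proof (intro allI impI)
    fix j k assume j: "j \<le> 2 * L"
    then have "dir n L j k \<bullet> x \<le> c * h j k"
      using net_bodyD[OF x j, of k] assms(2)[OF j, of k] by linarith
    then show "dir n L j k \<bullet> (x /\<^sub>R c) \<le> h j k"
      using assms(1) by (simp add: field_simps)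
  qed
  then show "x \<in> (*\<^sub>R) c ` net_body n L h"
    using assms(1) by (intro image_eqI[of _ _ "x /\<^sub>R c"]) auto
qed

lemma dir_inner_mirror:
  assumes "j \<le> 2 * L" "L \<ge> 1"
  shows "dir n L j k \<bullet> mirror x = dir n L (2 * L - j) k \<bullet> x"
proof -
  have "pi * real (2 * L - j) / (2 * real L) = pi - pi * real j / (2 * real L)"
    using assms by (simp add: of_nat_diff field_simps)
  then show ?thesis by (simp add: dir_def inner_3)
qed

lemma dir_nth3_nonneg:
  assumes "L \<le> j" "j \<le> 2 * L" "L \<ge> 1"
  shows "dir n L j k $ 3 \<ge> 0"
proof -
  have "cos (pi * real j / (2 * real L)) \<le> cos (pi / 2)"
    using assms latitude_range[OF assms(2)] by (intro cos_monotone_0_pi_le) (auto simp: field_simps)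
  then show ?thesis by (simp add: dir_def)
qed

lemma dir_nth3_nonpos:
  assumes "j \<le> L" "L \<ge> 1"
  shows "dir n L j k $ 3 \<le> 0"
proof -
  have "cos (pi * real j / (2 * real L)) \<ge> cos (pi / 2)"
    using assms by (intro cos_monotone_0_pi_le) (auto simp: field_simps)
  then show ?thesis by (simp add: dir_def)
qed

section \<open>Heights with a bulge and valleys\<close>

text \<open>A descending step has to lower the depth by at least one.  On the equator the depth grows with the distance to the next valley to
  the west, so that one can walk along the equator into that valley; the northern parallels start
  above all these values.\<close>

definition depth :: "nat \<Rightarrow> nat \<Rightarrow> nat \<Rightarrow> nat" where
  "depth L j k = (if j < L then j else if j = L then L + k mod (2 * L) else j + 2 * L)"

text \<open>The raised facets are those strictly between the south pole and the equator that are not on one of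
  the \<open>n\<close> valleys, the meridians with \<open>2 L dvd k\<close>.\<close>

definition bulging :: "nat \<Rightarrow> nat \<Rightarrow> nat \<Rightarrow> bool" where
  "bulging L j k \<longleftrightarrow> 0 < j \<and> j < L \<and> \<not> 2 * L dvd k"

text \<open>The base \<open>a\<close> is a parameter because two values are compared: with \<open>step_ratio L\<close> every step down is
  steep enough for descent, and with \<open>a = 1\<close> the heights are constant apart from the bulge, which makes
  the mirror argument exact.\<close>

definition height :: "nat \<Rightarrow> real \<Rightarrow> real \<Rightarrow> nat \<Rightarrow> nat \<Rightarrow> real" where
  "height L a t j k = (if bulging L j k then 1 + t else 1) * a ^ depth L j k"

lemma height_periodic: "height L a t j (k + 2 * L) = height L a t j k"
proof -
  have "2 * L dvd k + 2 * L \<longleftrightarrow> 2 * L dvd k" by (rule dvd_add_triv_right_iff)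
  then show ?thesis by (simp add: height_def depth_def bulging_def)
qed

lemma height_ge_1: "a \<ge> 1 \<Longrightarrow> t \<ge> 0 \<Longrightarrow> height L a t j k \<ge> 1"
  using mult_mono[of 1 "1 + t" 1 "a ^ depth L j k"] one_le_power[of a "depth L j k"]
  by (auto simp: height_def)

lemma depth_le:
  assumes "L \<ge> 1" "j \<le> 2 * L"
  shows "depth L j k \<le> 4 * L"
proof -
  have "k mod (2 * L) < 2 * L"
    using assms(1) by (intro mod_less_divisor) auto
  then have "L + k mod (2 * L) \<le> 4 * L" by linarith
  then show ?thesis using assms by (auto simp: depth_def)
qed

lemma height_le:
  assumes "L \<ge> 1" "j \<le> 2 * L" "a \<ge> 1" "t \<ge> 0"
  shows "height L a t j k \<le> a ^ (4 * L) * height L 1 t j k"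
proof -
  have "a ^ depth L j k \<le> a ^ (4 * L)"
    using depth_le[OF assms(1,2)] assms(3) by (rule power_increasing)
  then show ?thesis
    using assms(4) by (auto simp: height_def mult.commute intro!: mult_left_mono)
qed

lemma height_mono:
  assumes "1 \<le> a" "0 \<le> s" "s \<le> t"
  shows "height L 1 s j k \<le> height L a s j k" "height L a s j k \<le> height L a t j k"
    "height L a t j k \<le> (1 + (t - s)) * height L a s j k"
proof -
  have a: "1 \<le> a ^ depth L j k" using assms(1) by (rule one_le_power)
  show "height L 1 s j k \<le> height L a s j k"
    using a assms by (auto simp: height_def)
  show "height L a s j k \<le> height L a t j k"
    using a assms by (auto simp: height_def intro!: mult_right_mono)
  have "1 + t \<le> (1 + (t - s)) * (1 + s)"
    using assms by (simp add: algebra_simps mult_left_mono)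
  then have "(1 + t) * a ^ depth L j k \<le> (1 + (t - s)) * (1 + s) * a ^ depth L j k"
    using a by (intro mult_right_mono) auto
  moreover have "1 * a ^ depth L j k \<le> (1 + (t - s)) * a ^ depth L j k"
    using a assms by (intro mult_right_mono) auto
  ultimately show "height L a t j k \<le> (1 + (t - s)) * height L a s j k"
    by (simp add: height_def mult.assoc)
qed

text \<open>By this factor the height has to drop on a step to the next parallel, at angle \<open>\<pi> / (2 L)\<close>.\<close>

definition step_ratio :: "nat \<Rightarrow> real" where
  "step_ratio L = 1 / cos (pi / (2 * real L))"

lemma cos_step: "L \<ge> 2 \<Longrightarrow> 0 < cos (pi / (2 * real L)) \<and> cos (pi / (2 * real L)) < 1"
proof
  assume L: "L \<ge> 2"
  have lt: "pi / (2 * real L) < pi / 2" and pos: "0 < pi / (2 * real L)"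
    using L by (auto simp: field_simps)
  show "0 < cos (pi / (2 * real L))"
    using lt pos by (intro cos_gt_zero) auto
  show "cos (pi / (2 * real L)) < 1"
    using cos_monotone_0_pi[of 0 "pi / (2 * real L)"] lt pos by simp
qed

lemma step_ratio_gt_1: "L \<ge> 2 \<Longrightarrow> step_ratio L > 1"
  using cos_step[of L] by (simp add: step_ratio_def)

text \<open>The depth is at most \<open>4 L\<close>, and each unit of it costs a factor \<open>1 - O(1/L\<^sup>2)\<close>; Bernoulli's inequality adds
  these costs up.\<close>

lemma step_ratio_power_le:
  assumes "L \<ge> 2" "cos_mesh L > 0"
  shows "step_ratio L ^ (4 * L) \<le> 1 / cos_mesh L"
proof -
  let ?y = "pi\<^sup>2 / (8 * (real L)\<^sup>2)"
  have L: "real L \<ge> 2" using assms by simp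
  have "pi\<^sup>2 \<le> 4\<^sup>2" using pi_less_4 pi_gt_zero by (intro power_mono) auto
  moreover have "8 * 2\<^sup>2 \<le> 8 * (real L)\<^sup>2" using L by (intro mult_left_mono power_mono) auto
  ultimately have y: "?y \<le> 1" using L by (simp add: divide_le_eq)
  have "cos_mesh L = 1 + real (4 * L) * (- ?y)"
    using L by (simp add: cos_mesh_def field_simps power2_eq_square)
  also have "\<dots> \<le> (1 + (- ?y)) ^ (4 * L)"
    using y by (intro Bernoulli_inequality) auto
  also have "\<dots> \<le> cos (pi / (2 * real L)) ^ (4 * L)"
    using y cos_ge_quadratic[of "pi / (2 * real L)"]
    by (intro power_mono) (auto simp: power_divide power_mult_distrib)
  finally show ?thesis
    using assms(2) by (simp add: step_ratio_def power_divide frac_le)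
qed

abbreviation valley_body :: "nat \<Rightarrow> nat \<Rightarrow> real \<Rightarrow> real \<Rightarrow> (real^3) set" where
  "valley_body n L a t \<equiv> net_body n L (height L a t)"

text \<open>Away from the equator the facet just below on the same meridian will do: in the south both are raised,
  or the lower one is the south pole, or both are in a valley.  On the equator the facet below is usable
  only in a valley, since elsewhere it may be raised too high; there one steps west instead.  The step along the
  equator has angle \<open>\<pi> / (L n)\<close>, which \<open>n \<ge> 2\<close> makes no longer than a step between parallels.\<close>

lemma facet_has_lower_neighbour:
  assumes n: "n \<ge> 2" and L: "L \<ge> 2" and t: "t \<ge> 0" and j: "1 \<le> j" "j \<le> 2 * L"
  defines "h \<equiv> height L (step_ratio L) t"
  shows "\<exists>j' k'. j' \<le> 2 * L \<and> h j' k' < h j k \<and> h j' k' \<le> h j k * (dir n L j' k' \<bullet> dir n L j k)"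
proof -
  let ?a = "step_ratio L"
  have a: "?a > 1" using L by (rule step_ratio_gt_1)
  have hpos: "h j k > 0" for j k
    using height_ge_1[of ?a t L j k] a t by (simp add: h_def)
  \<comment> \<open>It suffices that the height drops by \<open>?a\<close> over an angle of at most \<open>\<pi> / (2 L)\<close>.\<close>
  have suff: ?thesis if "j' \<le> 2 * L" "h j' k' * ?a \<le> h j k"
    "cos (pi / (2 * real L)) \<le> dir n L j' k' \<bullet> dir n L j k" for j' k'
  proof (intro exI conjI)
    have "h j' k' * 1 < h j' k' * ?a"
      using a hpos by (intro mult_strict_left_mono)
    then show "h j' k' < h j k" using that(2) by simp
    have "h j' k' = h j' k' * ?a * cos (pi / (2 * real L))"
      using cos_step[OF L] by (simp add: step_ratio_def)
    also have "\<dots> \<le> h j k * cos (pi / (2 * real L))"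
      using that(2) cos_step[OF L] by (intro mult_right_mono) auto
    also have "\<dots> \<le> h j k * (dir n L j' k' \<bullet> dir n L j k)"
      using that(3) hpos[of j k] by (intro mult_left_mono) auto
    finally show "h j' k' \<le> h j k * (dir n L j' k' \<bullet> dir n L j k)" .
  qed (fact that(1))
  have down: "dir n L (j - 1) k \<bullet> dir n L j k = cos (pi / (2 * real L))"
  proof -
    have "pi * real (j - 1) / (2 * real L) - pi * real j / (2 * real L) = - (pi / (2 * real L))"
      using j(1) L by (simp add: of_nat_diff field_simps)
    then show ?thesis
      by (simp add: dir_def inner_sph) (metis add.commute cos_diff cos_minus)
  qed
  consider "j < L" | "j = L" "2 * L dvd k" | "j = L" "\<not> 2 * L dvd k" | "L < j" by linarith
  then show ?thesis
  proof cases
    case 1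
    have "h (j - 1) k * ?a = (if bulging L (j - 1) k then 1 + t else 1) * ?a ^ j"
      using 1 j by (cases j) (auto simp: h_def height_def depth_def)
    also have "\<dots> \<le> h j k"
      using 1 j t a by (auto simp: h_def height_def depth_def bulging_def intro!: mult_right_mono)
    finally show ?thesis
      using suff[of "j - 1" k] down j by simp
  next
    case 2
    have "h (j - 1) k * ?a = ?a ^ j"
      using 2 j by (cases j) (auto simp: h_def height_def depth_def bulging_def)
    also have "\<dots> \<le> h j k"
      using 2 a by (auto simp: h_def height_def depth_def bulging_def)
    finally show ?thesis
      using suff[of "j - 1" k] down j by simp
  next
    case 3
    have k: "k mod (2 * L) = Suc ((k - 1) mod (2 * L))"
      using 3 by (cases k) (auto simp: mod_Suc dvd_eq_mod_eq_0 split: if_splits)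
    have "h L (k - 1) * ?a \<le> h L k"
      using k by (simp add: h_def height_def depth_def bulging_def)
    moreover have "cos (pi / (2 * real L)) \<le> dir n L L (k - 1) \<bullet> dir n L L k"
    proof -
      have "k \<ge> 1" using 3 by (cases k) auto
      then have "pi * real (k - 1) / (real L * real n) - pi * real k / (real L * real n)
          = - (pi / (real L * real n))"
        by (simp add: of_nat_diff field_simps diff_divide_distrib)
      then have "dir n L L (k - 1) \<bullet> dir n L L k = cos (pi / (real L * real n))"
        using L by (simp add: dir_def inner_sph)
      moreover have "pi / (real L * real n) \<le> pi / (2 * real L)"
        using n L by (intro divide_left_mono) (auto simp: mult.commute)
      moreover have "pi / (2 * real L) \<le> pi"
        using L by (simp add: divide_le_eq)
      ultimately show ?thesis
        using cos_monotone_0_pi_le[of "pi / (real L * real n)" "pi / (2 * real L)"] by simp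
    qed
    ultimately show ?thesis
      using suff[of L "k - 1"] 3 by simp
  next
    case 4
    have "depth L (j - 1) k + 1 \<le> depth L j k"
    proof -
      have "k mod (2 * L) < 2 * L"
        using L by (intro mod_less_divisor) auto
      then have "j - 1 + k mod (2 * L) + 1 \<le> j + 2 * L" using j by linarith
      then show ?thesis using 4 by (auto simp: depth_def)
    qed
    then have "?a ^ (depth L (j - 1) k + 1) \<le> ?a ^ depth L j k"
      using a by (intro power_increasing) auto
    moreover have "\<not> bulging L (j - 1) k" "\<not> bulging L j k"
      using 4 by (auto simp: bulging_def)
    ultimately have "h (j - 1) k * ?a \<le> h j k"
      by (simp add: h_def height_def mult.commute)
    then show ?thesis
      using suff[of "j - 1" k] down j by simp
  qed
qed

lemma monostable_valley_body:
  assumes "n \<ge> 2" "L \<ge> 2" "t \<ge> 0" "center_of_mass (valley_body n L (step_ratio L) t) = 0"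
  shows "monostable (valley_body n L (step_ratio L) t)"
  unfolding net_body_def
proof (rule monostable_if_descending[where r = "sph 0 0" and c = 1])
  let ?a = "step_ratio L"
  let ?h = "height L ?a t"
  have a: "?a > 1" using assms(2) by (rule step_ratio_gt_1)
  have pole: "dir n L 0 k = sph 0 0" "?h 0 k = 1" for k
    using assms(2) by (auto simp: dir_def vec_eq_iff forall_3 height_def bulging_def depth_def)
  have above: "\<exists>j k. 1 \<le> j \<and> j \<le> 2 * L \<and> u = dir n L j k \<and> b = ?h j k"
    if ub: "(u, b) \<in> net_facets n L ?h - {(sph 0 0, 1)}" for u b
  proof -
    obtain j k where "j \<le> 2 * L" "u = dir n L j k" "b = ?h j k"
      using ub by (auto simp: net_facets_def)
    moreover have "j \<noteq> 0"
    proof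
      assume "j = 0"
      then show False using \<open>u = dir n L j k\<close> \<open>b = ?h j k\<close> ub pole by simp
    qed
    ultimately show ?thesis by (metis One_nat_def Suc_leI neq0_conv)
  qed
  show "finite (net_facets n L ?h)"
    using assms(1,2) height_periodic by (intro finite_net_facets) auto
  show "norm u = 1 \<and> b > 0" if "(u, b) \<in> net_facets n L ?h" for u b
  proof -
    obtain j k where "u = dir n L j k" "b = ?h j k"
      using \<open>(u, b) \<in> net_facets n L ?h\<close> by (auto simp: net_facets_def)
    then show ?thesis
      using height_ge_1[of ?a t L j k] a assms(3) by simp
  qed
  show "center_of_mass (halfspaces_body (net_facets n L ?h)) = 0"
    using assms(4) by (simp add: net_body_def)
  show "(sph 0 0, 1) \<in> net_facets n L ?h"
    using pole[of 0] by (force simp: net_facets_def)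
  show "1 < b" if ub: "(u, b) \<in> net_facets n L ?h - {(sph 0 0, 1)}" for u b
  proof -
    obtain j k where jk: "1 \<le> j" "j \<le> 2 * L" "b = ?h j k" using above[OF ub] by blast
    obtain j' k' where "?h j' k' < ?h j k"
      using facet_has_lower_neighbour[OF assms(1-3) jk(1,2)] by blast
    then show ?thesis
      using height_ge_1[of ?a t L j' k'] a assms(3) jk(3) by simp
  qed
  show "\<exists>(v, d) \<in> net_facets n L ?h. d < b \<and> d \<le> b * (v \<bullet> u)"
    if ub: "(u, b) \<in> net_facets n L ?h - {(sph 0 0, 1)}" for u b
  proof -
    obtain j k where jk: "1 \<le> j" "j \<le> 2 * L" "u = dir n L j k" "b = ?h j k"
      using above[OF ub] by blast
    obtain j' k' where "j' \<le> 2 * L" "?h j' k' < b" "?h j' k' \<le> b * (dir n L j' k' \<bullet> u)"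
      using facet_has_lower_neighbour[OF assms(1-3) jk(1,2), of k] jk(3,4) by blast
    then show ?thesis
      by (intro bexI[of _ "(dir n L j' k', ?h j' k')"]) (auto simp: net_facets_def)
  qed
qed

lemma compact_net_body:
  assumes "n \<ge> 1" "L \<ge> 2" "cos_mesh L > 0" "\<And>j k. h j (k + 2 * L) = h j k"
    and "\<And>j k. j \<le> 2 * L \<Longrightarrow> h j k \<le> M"
  shows "compact (net_body n L h)" "polytope (net_body n L h)"
proof -
  have "finite (net_facets n L h)"
    using assms(1,2,4) by (intro finite_net_facets) auto
  then have "polyhedron (net_body n L h)"
    unfolding net_body_def by (rule polyhedron_halfspaces_body)
  moreover have "bounded (net_body n L h)"
    using net_body_subset_cball[OF assms(2,1,3), of h M] assms(5) bounded_cball bounded_subset by blast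
  ultimately show "polytope (net_body n L h)"
    by (simp add: polytope_eq_bounded_polyhedron)
  then show "compact (net_body n L h)" by (rule polytope_imp_compact)
qed

lemma height_upper:
  assumes "L \<ge> 2" "j \<le> 2 * L" "a \<ge> 1" "0 \<le> t" "t \<le> \<eta>" "a ^ (4 * L) \<le> c"
  shows "height L a t j k \<le> c * (1 + \<eta>)"
proof -
  have "height L a t j k \<le> a ^ (4 * L) * height L 1 t j k"
    using assms by (intro height_le) auto
  also have "\<dots> \<le> c * (1 + \<eta>)"
    using assms order_trans[OF zero_le_one order_trans[OF one_le_power[of a "4 * L"]], of c] one_le_power[of a "4 * L"] by (intro mult_mono) (auto simp: height_def)
  finally show ?thesis .
qed

section \<open>The vertical moment without a bulge\<close>

text \<open>Without a bulge each northern height is at least the height at the mirror image, so the mirror image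
  of the lower half of the body lies in the body.\<close>

lemma z_moment_valley_body_0_nonneg:
  assumes "n \<ge> 1" "L \<ge> 2" "cos_mesh L > 0" "a \<ge> 1"
  shows "0 \<le> z_moment (valley_body n L a 0)"
proof -
  let ?B = "valley_body n L a 0"
  have comp: "compact ?B"
    using assms height_periodic height_upper[OF assms(2) _ assms(4), of _ 0 0]
    by (intro compact_net_body(1)[where M = "a ^ (4 * L) * (1 + 0)"]) auto
  have refl: "mirror x \<in> ?B" if x: "x \<in> ?B" "x $ 3 < 0" for x
    unfolding mem_net_body
  proof (intro allI impI)
    fix j k assume j: "j \<le> 2 * L"
    show "dir n L j k \<bullet> mirror x \<le> height L a 0 j k"
    proof (cases "j \<le> L")
      case True
      have "dir n L j k \<bullet> mirror x = dir n L j k \<bullet> x - 2 * (dir n L j k $ 3 * x $ 3)"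
        by (simp add: inner_3)
      also have "\<dots> \<le> dir n L j k \<bullet> x"
        using dir_nth3_nonpos[OF True, of n k] x(2) assms(2) by (simp add: mult_nonpos_nonpos)
      also have "\<dots> \<le> height L a 0 j k"
        using x(1) j by (rule net_bodyD)
      finally show ?thesis .
    next
      case False
      have "dir n L j k \<bullet> mirror x \<le> height L a 0 (2 * L - j) k"
        using dir_inner_mirror[OF j, of n k x] net_bodyD[OF x(1), of "2 * L - j" k] assms(2) by simp
      also have "\<dots> \<le> height L a 0 j k"
        using False j assms(4) by (auto simp: height_def depth_def intro!: power_increasing)
      finally show ?thesis .
    qed
  qed
  have "z_moment (mirror ` ?B) \<le> z_moment ?B"
  proof (rule z_moment_mono)
    show "compact (mirror ` ?B)"
      using comp by (rule compact_mirror)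
    show "x \<in> ?B" if "x \<in> mirror ` ?B" "x $ 3 > 0" for x
      using that refl by auto
    show "x \<in> mirror ` ?B" if "x \<in> ?B" "x $ 3 < 0" for x
      using refl[OF that] by (metis image_eqI mirror_mirror)
  qed (fact comp)
  then show ?thesis
    using z_moment_mirror[OF comp] by simp
qed

section \<open>A ball inside the bulge\<close>

text \<open>The point with longitude \<open>\<pi> / n\<close> is midway between two valleys, so no valley is closer to it in
  longitude than \<open>\<pi> / n\<close>.\<close>

lemma cos_odd_multiple_le:
  assumes "n \<ge> 1"
  shows "cos (2 * pi * real i / real n - pi / real n) \<le> cos (pi / real n)"
proof -
  let ?f = "\<lambda>i. cos (2 * pi * real i / real n - pi / real n)"
  have small: "?f i \<le> cos (pi / n)" if "i < n" for i
  proof (cases "i = 0")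
    case False
    define \<alpha> where "\<alpha> = 2 * pi * real i / real n - pi / real n"
    have i: "1 \<le> real i" "real i \<le> real n - 1" using False that by auto
    have "\<alpha> = (2 * real i - 1) * (pi / n)"
      by (simp add: \<alpha>_def algebra_simps diff_divide_distrib)
    moreover have "1 * (pi / n) \<le> (2 * real i - 1) * (pi / n)"
      "(2 * real i - 1) * (pi / n) \<le> (2 * real n - 1) * (pi / n)"
      using i by (intro mult_right_mono; simp)+
    moreover have "(2 * real n - 1) * (pi / n) = 2 * pi - pi / n"
      using assms by (simp add: field_simps)
    ultimately have \<alpha>: "pi / n \<le> \<alpha>" "pi / n \<le> 2 * pi - \<alpha>" by auto
    show ?thesis
    proof (cases "\<alpha> \<le> pi")
      case True
      then show ?thesis
        using cos_monotone_0_pi_le[OF _ \<alpha>(1)] by (simp add: \<alpha>_def)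
    next
      case False
      have "cos \<alpha> = cos (2 * pi - \<alpha>)" by simp
      also have "\<dots> \<le> cos (pi / n)"
        using \<alpha>(2) False by (intro cos_monotone_0_pi_le) auto
      finally show ?thesis by (simp add: \<alpha>_def)
    qed
  qed simp
  have per: "?f (i + n) = ?f i" for i
  proof -
    have "2 * pi * real (i + n) / n - pi / n = 2 * pi * real i / n - pi / n + 2 * pi"
      using assms by (simp add: field_simps)
    then have "?f (i + n) = cos (2 * pi * real i / n - pi / n + 2 * pi)"
      by (simp only:)
    then show ?thesis by (simp only: cos_periodic)
  qed
  have "?f i = ?f (i mod n)"
    using nat_periodic_mult[where f = ?f, OF per, of "i mod n" "i div n"] by simp
  also have "\<dots> \<le> cos (pi / n)"
    using assms by (intro small) auto
  finally show ?thesis .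
qed

text \<open>Any southern direction off the valleys would do.  This one is midway between two valleys, and the
  polar angle \<open>\<pi> / 4\<close> bounds its inner products with northern directions by \<open>1 / sqrt 2\<close>.\<close>

definition bulge_center :: "nat \<Rightarrow> real^3" where
  "bulge_center n = sph (pi / 4) (pi / real n)"

text \<open>If \<open>\<gamma> = cos (\<pi> / n)\<close>, then on a valley the inner product with \<open>bulge_center\<close> is at most
  \<open>(\<gamma> sin \<theta> + cos \<theta>) / sqrt 2\<close>.  The present value is the Cauchy-Schwarz bound of this over all \<open>\<theta>\<close>.\<close>

definition bulge_cos :: "nat \<Rightarrow> real" where
  "bulge_cos n = sqrt ((1 + (cos (pi / real n))\<^sup>2) / 2)"

lemma bulge_cos_less_1:
  assumes "n \<ge> 2"
  shows "bulge_cos n < 1"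
proof -
  have "0 < pi / n" "pi / n \<le> pi / 2"
    using assms by (auto simp: field_simps)
  moreover have "pi / n \<le> pi"
    using calculation by linarith
  ultimately have "0 \<le> cos (pi / n)" "cos (pi / n) < 1"
    using cos_monotone_0_pi[of 0 "pi / n"] by (auto intro!: cos_ge_zero)
  then have "(cos (pi / n))\<^sup>2 < 1" by (simp add: power_less_one_iff)
  then show ?thesis by (simp add: bulge_cos_def)
qed

lemma bulge_center_inner_le:
  assumes "n \<ge> 1" "L \<ge> 1" "j \<le> 2 * L" "\<not> bulging L j k"
  shows "dir n L j k \<bullet> bulge_center n \<le> bulge_cos n"
proof -
  define \<theta> where "\<theta> = pi * real j / (2 * real L)"
  define \<delta> where "\<delta> = pi * real k / (real L * real n) - pi / real n"
  let ?g = "cos (pi / real n)"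
  have \<theta>: "0 \<le> \<theta>" "\<theta> \<le> pi" using latitude_range[OF assms(3)] by (simp_all add: \<theta>_def)
  then have s: "0 \<le> sin \<theta>" by (rule sin_ge_zero)
  have eq: "dir n L j k \<bullet> bulge_center n = (sin \<theta> * cos \<delta> + cos \<theta>) * (sqrt 2 / 2)"
    by (simp add: dir_def bulge_center_def inner_sph \<theta>_def \<delta>_def cos_45 sin_45 algebra_simps)
  have half: "sqrt 2 / 2 \<le> bulge_cos n"
    unfolding bulge_cos_def by (rule real_le_rsqrt) (simp add: power_divide)
  have one: "sin \<theta> * cos \<delta> \<le> 1"
    using mult_left_mono[OF cos_le_one s, of \<delta>] sin_le_one[of \<theta>] by linarith
  consider "j = 0" | "L \<le> j" | "j < L" "2 * L dvd k"
    using assms(4) by (metis bulging_def gr0I not_less)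
  then show ?thesis
  proof cases
    case 1
    then show ?thesis using eq half by (simp add: \<theta>_def)
  next
    case 2
    have "cos \<theta> \<le> 0"
      using dir_nth3_nonneg[OF 2 assms(3,2), of n k] by (simp add: dir_def \<theta>_def)
    then have "(sin \<theta> * cos \<delta> + cos \<theta>) * (sqrt 2 / 2) \<le> 1 * (sqrt 2 / 2)"
      using one by (intro mult_right_mono) auto
    then show ?thesis using eq half by linarith
  next
    case 3
    obtain i where i: "k = 2 * L * i" using 3 by blast
    have "\<delta> = 2 * pi * real i / real n - pi / real n"
      using assms(1,2) by (simp add: \<delta>_def i)
    then have "cos \<delta> \<le> ?g" using cos_odd_multiple_le[OF assms(1)] by simp
    then have "(sin \<theta> * cos \<delta> + cos \<theta>) * (sqrt 2 / 2) \<le> (sin \<theta> * ?g + cos \<theta>) * (sqrt 2 / 2)"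
      using s by (intro mult_right_mono add_right_mono mult_left_mono) auto
    also have "\<dots> \<le> bulge_cos n"
      unfolding bulge_cos_def
    proof (rule real_le_rsqrt)
      have "(x * ?g + y)\<^sup>2 + (y * ?g - x)\<^sup>2 = (x\<^sup>2 + y\<^sup>2) * (1 + ?g\<^sup>2)" for x y :: real
        by (simp add: power2_eq_square algebra_simps)
      from this[of "sin \<theta>" "cos \<theta>"] have "(sin \<theta> * ?g + cos \<theta>)\<^sup>2 \<le> 1 + ?g\<^sup>2"
        using zero_le_power2[of "cos \<theta> * ?g - sin \<theta>"] unfolding sin_cos_squared_add mult_1
        by linarith
      then show "((sin \<theta> * ?g + cos \<theta>) * (sqrt 2 / 2))\<^sup>2 \<le> (1 + ?g\<^sup>2) / 2"
        by (simp add: power_mult_distrib power_divide)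
    qed
    finally show ?thesis using eq by simp
  qed
qed

text \<open>With \<open>a = 1\<close> the northern heights are \<open>1\<close> and the southern ones at least \<open>1\<close>, so the mirror image of
  the upper half of the body lies in the body.  The gain is a ball around \<open>(1 + \<eta> / 2)\<close> times
  \<open>bulge_center\<close>: the bound on \<open>\<eta>\<close> keeps it below the planes of the valleys and of the north, and it
  lies outside the mirror image because the northern part of a fine net cuts off all points at
  distance \<open>1 + \<eta> / 4\<close> from the center.\<close>

lemma z_moment_valley_body_bulge:
  assumes n: "n \<ge> 1" and L: "L \<ge> 2" and \<eta>: "0 < \<eta>" "\<eta> \<le> 1 - bulge_cos n"
    and mesh: "cos_mesh L * (1 + \<eta> / 4) > 1"
  shows "z_moment (valley_body n L 1 \<eta>) \<le> - (measure lebesgue (cball (0::real^3) (\<eta> / 4)) / 4)"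
proof -
  let ?B = "valley_body n L 1 \<eta>" and ?w = "(1 + \<eta> / 2) *\<^sub>R bulge_center n"
  let ?W = "cball ?w (\<eta> / 4)"
  have mpos: "cos_mesh L > 0"
    using mesh \<eta>(1) by (smt (verit) divide_nonneg_nonneg mult_nonpos_nonneg)
  have comp: "compact ?B"
  proof (rule compact_net_body(1)[where M = "1 + \<eta>"])
    show "height L 1 \<eta> j k \<le> 1 + \<eta>" for j k
      using \<eta>(1) by (simp add: height_def)
  qed (use n L mpos height_periodic in auto)
  have b1: "\<eta> \<le> 1"
    using \<eta>(2) by (smt (verit) bulge_cos_def real_sqrt_ge_zero zero_le_power2 divide_nonneg_nonneg)
  have W: "x $ 3 \<le> - (1 / 2)" "norm x \<ge> 1 + \<eta> / 4" "norm x \<le> 1 + \<eta>" "norm (x - ?w) \<le> \<eta> / 4"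
    if "x \<in> ?W" for x
  proof -
    show d: "norm (x - ?w) \<le> \<eta> / 4"
      using that by (simp add: dist_norm norm_minus_commute)
    have nw: "norm ?w = 1 + \<eta> / 2" using \<eta>(1) by (simp add: bulge_center_def)
    show "norm x \<ge> 1 + \<eta> / 4" "norm x \<le> 1 + \<eta>"
      using d nw norm_triangle_ineq2[of ?w x] norm_triangle_ineq2[of x ?w] \<eta>(1)
      by (auto simp: norm_minus_commute)
    have "1 / 2 \<le> sqrt 2 / 2" by simp
    then have "(1 + \<eta> / 2) * (1 / 2) \<le> (1 + \<eta> / 2) * (sqrt 2 / 2)"
      using \<eta>(1) by (intro mult_left_mono) auto
    then have "?w $ 3 \<le> - ((1 + \<eta> / 2) * (1 / 2))"
      by (simp add: bulge_center_def cos_45)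
    moreover have "x $ 3 - ?w $ 3 \<le> \<eta> / 4"
      using component_le_norm_cart[of "x - ?w" 3] d by simp
    ultimately show "x $ 3 \<le> - (1 / 2)" by (simp add: algebra_simps)
  qed
  have sub: "?W \<subseteq> ?B"
  proof
    fix x assume x: "x \<in> ?W"
    show "x \<in> ?B"
      unfolding mem_net_body
    proof (intro allI impI)
      fix j k assume j: "j \<le> 2 * L"
      show "dir n L j k \<bullet> x \<le> height L 1 \<eta> j k"
      proof (cases "bulging L j k")
        case True
        then show ?thesis
          using norm_cauchy_schwarz[of "dir n L j k" x] W(3)[OF x] by (simp add: height_def)
      next
        case False
        have "dir n L j k \<bullet> x = (1 + \<eta> / 2) * (dir n L j k \<bullet> bulge_center n) + dir n L j k \<bullet> (x - ?w)"
          by (simp add: inner_diff_right)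
        also have "\<dots> \<le> (1 + \<eta> / 2) * bulge_cos n + \<eta> / 4"
          using bulge_center_inner_le[OF n _ j False] L \<eta>(1) W(4)[OF x]
            norm_cauchy_schwarz[of "dir n L j k" "x - ?w"]
          by (intro add_mono mult_left_mono) auto
        also have "\<dots> \<le> (1 + \<eta> / 2) * (1 - \<eta>) + \<eta> / 4"
          using \<eta> by (intro add_right_mono mult_left_mono) auto
        also have "\<dots> \<le> 1"
          using \<eta>(1) zero_le_square[of \<eta>] by (simp add: algebra_simps)
        finally show ?thesis using False by (simp add: height_def)
      qed
    qed
  qed
  have disj: "?W \<inter> mirror ` ?B = {}"
  proof (rule ccontr)
    assume "?W \<inter> mirror ` ?B \<noteq> {}"
    then obtain y where y: "y \<in> ?B" "mirror y \<in> ?W" by auto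
    have y3: "y $ 3 \<ge> 0" "y \<noteq> 0" using W(1)[OF y(2)] by auto
    have ny: "norm y \<ge> 1 + \<eta> / 4"
      using W(2)[OF y(2)] orthogonal_transformation_norm[OF orthogonal_mirror, of y] by simp
    obtain j k where jk: "j \<le> 2 * L" "L \<le> j" "dir n L j k \<bullet> y \<ge> cos_mesh L * norm y"
      using dir_net[OF L n, of y] y3 by metis
    have "1 < cos_mesh L * norm y"
      using mesh ny mpos by (smt (verit) mult_left_mono)
    then show False
      using jk net_bodyD[OF y(1) jk(1), of k] by (simp add: height_def bulging_def)
  qed
  have refl: "mirror x \<in> ?B" if x: "x \<in> ?B" "x $ 3 > 0" for x
    unfolding mem_net_body
  proof (intro allI impI)
    fix j k assume j: "j \<le> 2 * L"
    show "dir n L j k \<bullet> mirror x \<le> height L 1 \<eta> j k"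
    proof (cases "L \<le> j")
      case True
      have "dir n L j k \<bullet> mirror x = dir n L j k \<bullet> x - 2 * (dir n L j k $ 3 * x $ 3)"
        by (simp add: inner_3)
      also have "\<dots> \<le> dir n L j k \<bullet> x"
        using dir_nth3_nonneg[OF True j, of n k] x(2) L by simp
      also have "\<dots> \<le> height L 1 \<eta> j k"
        using x(1) j by (rule net_bodyD)
      finally show ?thesis .
    next
      case False
      have "dir n L j k \<bullet> mirror x \<le> height L 1 \<eta> (2 * L - j) k"
        using dir_inner_mirror[OF j, of n k x] net_bodyD[OF x(1), of "2 * L - j" k] L by simp
      also have "\<dots> \<le> height L 1 \<eta> j k"
        using False j \<eta>(1) by (auto simp: height_def bulging_def)
      finally show ?thesis .
    qed
  qed
  have "z_moment ?B + 1 / 2 * measure lebesgue ?W \<le> z_moment (mirror ` ?B)"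
  proof (rule z_moment_mono_gain)
    show "compact (mirror ` ?B)"
      using comp by (rule compact_mirror)
    show "x \<in> mirror ` ?B" if "x \<in> ?B" "x $ 3 > 0" for x
      using refl[OF that] by (metis image_eqI mirror_mirror)
    show "x \<in> ?B" if "x \<in> mirror ` ?B" "x $ 3 < 0" for x
      using that refl by auto
  qed (use comp sub disj W in auto)
  moreover have "measure lebesgue ?W = measure lebesgue (cball (0::real^3) (\<eta> / 4))"
    using measure_translation[of ?w "cball 0 (\<eta> / 4)"] by (simp add: cball_translation[symmetric])
  ultimately show ?thesis
    using z_moment_mirror[OF comp] by simp
qed

section \<open>Dependence of the vertical moment on the bulge\<close>

lemma cube_minus_1_le:
  fixes d :: real
  assumes "0 \<le> d" "d \<le> 1"
  shows "(1 + d) ^ 3 - 1 \<le> 7 * d"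
proof -
  have "d * d \<le> d * 1" "d * d * d \<le> d * d * 1"
    using assms by (intro mult_left_mono; simp)+
  moreover have "(1 + d) ^ 3 - 1 = 3 * d + 3 * (d * d) + d * d * d"
    by (simp add: power3_eq_cube algebra_simps)
  ultimately show ?thesis by linarith
qed

text \<open>Raising the bulge from \<open>s\<close> to \<open>t\<close> enlarges the body at most by the factor \<open>1 + (t - s)\<close>, so by
  \<open>z_moment_squeezed\<close> the moment is Lipschitz in \<open>t\<close>.\<close>

lemma continuous_z_moment_valley_body:
  assumes n: "n \<ge> 1" and L: "L \<ge> 2" "cos_mesh L > 0" and a: "a \<ge> 1" and \<eta>: "\<eta> \<le> 1"
  shows "continuous_on {0..\<eta>} (\<lambda>t. z_moment (valley_body n L a t))"
proof -
  define M where "M = a ^ (4 * L) * (1 + 1)"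
  define R where "R = M / cos_mesh L"
  define V where "V = measure lebesgue (cball (0::real^3) R)"
  let ?m = "\<lambda>t. z_moment (valley_body n L a t)"
  have up: "height L a t j k \<le> M" if "j \<le> 2 * L" "0 \<le> t" "t \<le> 1" for t j k
    unfolding M_def using that by (intro height_upper[OF L(1) _ a]) auto
  have M0: "M \<ge> 0" using a by (simp add: M_def)
  then have R0: "R \<ge> 0" using L(2) by (simp add: R_def)
  have comp: "compact (valley_body n L a t)" and sub: "valley_body n L a t \<subseteq> cball 0 R"
    if "0 \<le> t" "t \<le> 1" for t
  proof -
    show "compact (valley_body n L a t)"
      using n L height_periodic up that by (intro compact_net_body(1)[where M = M]) auto
    show "valley_body n L a t \<subseteq> cball 0 R"
      unfolding R_def using n L up that by (intro net_body_subset_cball) auto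
  qed
  have main: "\<bar>?m t - ?m s\<bar> \<le> (7 * R * V) * (t - s)" if st: "0 \<le> s" "s \<le> t" "t \<le> 1" for s t
  proof -
    have "\<bar>?m t - ?m s\<bar> \<le> R * (((1 + (t - s)) ^ 3 - 1) * measure lebesgue (valley_body n L a s))"
    proof (rule z_moment_squeezed)
      show "valley_body n L a s \<subseteq> valley_body n L a t"
        using height_mono(2)[OF a] st by (intro net_body_mono) auto
      show "valley_body n L a t \<subseteq> (*\<^sub>R) (1 + (t - s)) ` valley_body n L a s"
        using height_mono(3)[OF a] st by (intro net_body_scaled) auto
      show "\<bar>x $ 3\<bar> \<le> R" if "x \<in> valley_body n L a t" for x
      proof -
        have "norm x \<le> R" using sub[of t] that st by auto
        then show ?thesis using component_le_norm_cart[of x 3] by linarith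
      qed
    qed (use comp st in auto)
    also have "\<dots> \<le> R * ((7 * (t - s)) * V)"
    proof (rule mult_left_mono[OF mult_mono])
      show "(1 + (t - s)) ^ 3 - 1 \<le> 7 * (t - s)"
        using st by (intro cube_minus_1_le) auto
      show "measure lebesgue (valley_body n L a s) \<le> V"
        unfolding V_def using sub[of s] comp[of s] st
        by (intro measure_mono_fmeasurable) (auto simp: lmeasurable_compact fmeasurableD)
    qed (use R0 st in auto)
    finally show ?thesis by (simp add: algebra_simps)
  qed
  have "(7 * R * V)-lipschitz_on {0..\<eta>} ?m"
  proof (rule lipschitz_onI)
    show "dist (?m s) (?m t) \<le> (7 * R * V) * dist s t" if "s \<in> {0..\<eta>}" "t \<in> {0..\<eta>}" for s t
      using that main[of s t] main[of t s] \<eta> by (cases "s \<le> t") (auto simp: dist_real_def)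
    show "0 \<le> 7 * R * V" using R0 by (simp add: V_def)
  qed
  then show ?thesis by (rule lipschitz_on_continuous_on)
qed

section \<open>Choice of the parameters\<close>

lemma hausdorff_dist_unit_ball_le:
  fixes P :: "'a::euclidean_space set"
  assumes "cball 0 1 \<subseteq> P" "P \<subseteq> cball 0 (1 + \<rho>)" "\<rho> \<ge> 0"
  shows "hausdorff_dist P (cball 0 1) \<le> \<rho>"
proof -
  have "infdist a (cball 0 1) \<le> \<rho>" if "a \<in> P" for a
  proof (cases "norm a \<le> 1")
    case True
    then show ?thesis using assms(3) by (simp add: infdist_zero)
  next
    case False
    have "infdist a (cball 0 1) \<le> dist a (a /\<^sub>R norm a)"
    proof (rule infdist_le)
      show "a /\<^sub>R norm a \<in> cball 0 1"
        using False by (cases "a = 0") auto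
    qed
    also have "\<dots> = norm ((norm a - 1) *\<^sub>R (a /\<^sub>R norm a))"
    proof -
      have "norm a \<noteq> 0" using False by auto
      then have "a - a /\<^sub>R norm a = (norm a - 1) *\<^sub>R (a /\<^sub>R norm a)"
        unfolding scaleR_diff_left by simp
      then show ?thesis by (simp only: dist_norm)
    qed
    also have "\<dots> = norm a - 1" using False by (cases "a = 0") auto
    also have "\<dots> \<le> \<rho>" using assms(2) that by auto
    finally show ?thesis .
  qed
  moreover have "infdist b P \<le> \<rho>" if "b \<in> cball 0 1" for b
    using that assms(1,3) by (metis infdist_zero subsetD)
  moreover have "P \<noteq> {}" "cball (0::'a) 1 \<noteq> {}" using assms(1) by auto
  ultimately show ?thesis
    unfolding hausdorff_dist_def by (intro max.boundedI cSUP_least) auto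
qed

lemma cos_mesh_tendsto_1: "cos_mesh \<longlonglongrightarrow> 1"
proof -
  have "(\<lambda>L. 1 - pi\<^sup>2 / 2 * (1 / real L)) \<longlonglongrightarrow> 1 - pi\<^sup>2 / 2 * 0"
    by (intro tendsto_intros lim_1_over_n)
  then show ?thesis by (simp add: cos_mesh_def[abs_def])
qed

lemma fine_mesh_exists:
  assumes "0 < \<eta>" "0 < g"
  obtains L where "L \<ge> 2" "cos_mesh L > 0" "cos_mesh L * (1 + \<eta> / 4) > 1"
    "(1 + \<eta>) / (cos_mesh L)\<^sup>2 \<le> 1 + 2 * \<eta>" "((1 / cos_mesh L) ^ 3 - 1) * c \<le> g"
proof -
  note lims = tendsto_intros cos_mesh_tendsto_1
  have "(\<lambda>L. cos_mesh L * (1 + \<eta> / 4)) \<longlonglongrightarrow> 1 * (1 + \<eta> / 4)"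
    by (intro lims)
  then have 1: "\<forall>\<^sub>F L in sequentially. cos_mesh L * (1 + \<eta> / 4) > 1"
    using assms(1) by (intro order_tendstoD(1)) auto
  have "(\<lambda>L. (1 + \<eta>) / (cos_mesh L)\<^sup>2) \<longlonglongrightarrow> (1 + \<eta>) / 1\<^sup>2"
    by (intro lims) auto
  then have 2: "\<forall>\<^sub>F L in sequentially. (1 + \<eta>) / (cos_mesh L)\<^sup>2 < 1 + 2 * \<eta>"
    using assms(1) by (intro order_tendstoD(2)) auto
  have "(\<lambda>L. ((1 / cos_mesh L) ^ 3 - 1) * c) \<longlonglongrightarrow> ((1 / 1) ^ 3 - 1) * c"
    by (intro lims) auto
  then have 3: "\<forall>\<^sub>F L in sequentially. ((1 / cos_mesh L) ^ 3 - 1) * c < g"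
    using assms(2) by (intro order_tendstoD(2)) auto
  have 4: "\<forall>\<^sub>F L in sequentially. cos_mesh L > 0"
    using cos_mesh_tendsto_1 by (intro order_tendstoD(1)) auto
  have "\<forall>\<^sub>F L in sequentially. L \<ge> 2 \<and> cos_mesh L > 0 \<and> cos_mesh L * (1 + \<eta> / 4) > 1 \<and>
      (1 + \<eta>) / (cos_mesh L)\<^sup>2 < 1 + 2 * \<eta> \<and> ((1 / cos_mesh L) ^ 3 - 1) * c < g"
    using 1 2 3 4 eventually_ge_at_top[of 2] by eventually_elim auto
  then obtain L where "L \<ge> 2 \<and> cos_mesh L > 0 \<and> cos_mesh L * (1 + \<eta> / 4) > 1 \<and>
      (1 + \<eta>) / (cos_mesh L)\<^sup>2 < 1 + 2 * \<eta> \<and> ((1 / cos_mesh L) ^ 3 - 1) * c < g"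
    unfolding eventually_sequentially by blast
  then show ?thesis using that[of L] by simp
qed

theorem theorem1:
  fixes n :: nat and \<epsilon> :: real
  assumes "n \<ge> 3" and "\<epsilon> > 0"
  shows "\<exists>P :: (real^3) set.
           convex_polyhedron P \<and> monostable P \<and> has_rotational_symmetry n P \<and>
           hausdorff_dist P (cball 0 1) < \<epsilon>"
proof -
  \<comment> \<open>The fixed bulge \<open>\<eta>\<close> comes first; the net is then refined depending on it.\<close>
  define \<eta> where "\<eta> = min (\<epsilon> / 4) (1 - bulge_cos n)"
  have n: "n \<ge> 1" "n \<ge> 2" using assms(1) by auto
  have \<eta>: "0 < \<eta>" "\<eta> \<le> 1 - bulge_cos n" "\<eta> \<le> \<epsilon> / 4"
    unfolding \<eta>_def using assms(2) bulge_cos_less_1[OF n(2)] by linarith+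
  have "bulge_cos n \<ge> 0" by (simp add: bulge_cos_def)
  then have \<eta>1: "\<eta> \<le> 1" using \<eta>(2) by linarith
  define g where "g = measure lebesgue (cball (0::real^3) (\<eta> / 4)) / 4"
  \<comment> \<open>All bodies below lie in the ball of radius \<open>1 + 2 * \<eta> \<le> 3\<close>.\<close>
  define V where "V = measure lebesgue (cball (0::real^3) 3)"
  have "g > 0" using \<eta>(1) by (simp add: g_def content_cball_pos)
  then obtain L where L: "L \<ge> 2" "cos_mesh L > 0" and mesh: "cos_mesh L * (1 + \<eta> / 4) > 1"
    and fine: "(1 + \<eta>) / (cos_mesh L)\<^sup>2 \<le> 1 + 2 * \<eta>" "((1 / cos_mesh L) ^ 3 - 1) * (3 * V) \<le> g"
    using fine_mesh_exists[OF \<eta>(1)] by metis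
  define a where "a = step_ratio L"
  define c where "c = 1 / cos_mesh L"
  have a: "a \<ge> 1" "a ^ (4 * L) \<le> c"
    using step_ratio_gt_1[OF L(1)] step_ratio_power_le[OF L] by (auto simp: a_def c_def)
  have c1: "c \<ge> 1" using a one_le_power[OF a(1), of "4 * L"] by linarith
  have up: "height L b t j k \<le> c * (1 + \<eta>)"
    if "j \<le> 2 * L" "0 \<le> t" "t \<le> \<eta>" "b = 1 \<or> b = a" for t j k b
    using that a c1 by (intro height_upper[OF L(1)]) auto
  have comp: "compact (valley_body n L b t)" "polytope (valley_body n L b t)"
    and ball: "valley_body n L b t \<subseteq> cball 0 (1 + 2 * \<eta>)" "cball 0 1 \<subseteq> valley_body n L b t"
    if "0 \<le> t" "t \<le> \<eta>" "b = 1 \<or> b = a" for t b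
  proof -
    show "compact (valley_body n L b t)" "polytope (valley_body n L b t)"
      using n(1) L height_periodic up that by (auto intro!: compact_net_body[where M = "c * (1 + \<eta>)"])
    have "valley_body n L b t \<subseteq> cball 0 (c * (1 + \<eta>) / cos_mesh L)"
      using n(1) L up that by (intro net_body_subset_cball) auto
    also have "c * (1 + \<eta>) / cos_mesh L = (1 + \<eta>) / (cos_mesh L)\<^sup>2"
      by (simp add: c_def power2_eq_square)
    finally show "valley_body n L b t \<subseteq> cball 0 (1 + 2 * \<eta>)"
      using fine(1) subset_cball by blast
    show "cball 0 1 \<subseteq> valley_body n L b t"
      using that a(1) by (intro cball_subset_net_body height_ge_1) auto
  qed
  \<comment> \<open>Constant heights leave the margin \<open>g\<close>, which absorbs the passage from base \<open>1\<close> to base \<open>a\<close>.\<close>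
  have "z_moment (valley_body n L a \<eta>) \<le> 0"
  proof -
    let ?Q = "valley_body n L 1 \<eta>" and ?P = "valley_body n L a \<eta>"
    have "\<bar>z_moment ?P - z_moment ?Q\<bar> \<le> 3 * ((c ^ 3 - 1) * measure lebesgue ?Q)"
    proof (rule z_moment_squeezed[OF _ _ _ _ c1])
      show "?Q \<subseteq> ?P"
        using height_mono(1)[OF a(1), of \<eta> \<eta>] \<eta>(1) by (intro net_body_mono) auto
      show "?P \<subseteq> (*\<^sub>R) c ` ?Q"
      proof (rule net_body_scaled)
        fix j k assume "j \<le> 2 * L"
        then have "height L a \<eta> j k \<le> a ^ (4 * L) * height L 1 \<eta> j k"
          using L a(1) \<eta>(1) by (intro height_le) auto
        also have "\<dots> \<le> c * height L 1 \<eta> j k"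
          using a(2) height_ge_1[of 1 \<eta> L j k] \<eta>(1) by (intro mult_right_mono) auto
        finally show "height L a \<eta> j k \<le> c * height L 1 \<eta> j k" .
      qed (use c1 in auto)
      show "\<bar>x $ 3\<bar> \<le> 3" if "x \<in> ?P" for x
      proof -
        have "norm x \<le> 1 + 2 * \<eta>" using ball(1)[of \<eta> a] \<eta>(1) that by auto
        then show ?thesis using component_le_norm_cart[of x 3] \<eta>1 by linarith
      qed
    qed (use comp \<eta>(1) in auto)
    also have "\<dots> \<le> 3 * ((c ^ 3 - 1) * V)"
    proof (intro mult_left_mono)
      have "?Q \<subseteq> cball 0 3"
        using ball(1)[of \<eta> 1] \<eta>(1) \<eta>1 subset_cball[of "1 + 2 * \<eta>" 3 "0::real^3"] by auto
      then show "measure lebesgue ?Q \<le> V"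
        unfolding V_def using comp(1)[of \<eta> 1] \<eta>(1)
        by (intro measure_mono_fmeasurable) (auto simp: lmeasurable_compact fmeasurableD)
    qed (use c1 in auto)
    also have "\<dots> \<le> g" using fine(2) by (simp add: c_def algebra_simps)
    finally show ?thesis
      using z_moment_valley_body_bulge[OF n(1) L(1) \<eta>(1,2) mesh] unfolding g_def by linarith
  qed
  moreover have "0 \<le> z_moment (valley_body n L a 0)"
    using z_moment_valley_body_0_nonneg[OF n(1) L a(1)] .
  ultimately obtain t where t: "0 \<le> t" "t \<le> \<eta>" "z_moment (valley_body n L a t) = 0"
    using IVT2'[of "\<lambda>t. z_moment (valley_body n L a t)" \<eta> 0 0]
      continuous_z_moment_valley_body[OF n(1) L a(1) \<eta>1] \<eta>(1) by auto
  let ?P = "valley_body n L a t"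
  note comp = comp[OF t(1,2), of a, simplified] and ball = ball[OF t(1,2), of a, simplified]
  have rot: "rotation_about 0 (axis 3 1) (2 * pi / n) ` ?P = ?P"
    using n(1) L(1) height_periodic by (intro net_body_rotation) auto
  have "cos (2 * pi / n) \<noteq> 1"
  proof -
    have "2 * pi / n \<le> pi" "0 < 2 * pi / n"
      using n(2) by (auto simp: divide_le_eq)
    then show ?thesis using cos_monotone_0_pi[of 0 "2 * pi / n"] by auto
  qed
  then have com: "center_of_mass ?P = 0"
    using center_of_mass_rotationally_symmetric comp(1) rot t(3) by blast
  show ?thesis
  proof (intro exI conjI)
    have "0 \<in> interior ?P"
      using ball(2) by (meson ball_subset_cball centre_in_ball interior_maximal open_ball
          order_trans subsetD zero_less_one)
    then show "convex_polyhedron ?P"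
      using comp by (auto simp: convex_polyhedron_def convex_body_def polytope_imp_convex)
    show "monostable ?P"
      using monostable_valley_body[OF n(2) L(1) t(1)] com by (simp add: a_def)
    show "has_rotational_symmetry n ?P"
      unfolding has_rotational_symmetry_def using rot by (intro exI[of _ 0] exI[of _ "axis 3 1"]) simp
    have "hausdorff_dist ?P (cball 0 1) \<le> 2 * \<eta>"
      using ball \<eta>(1) by (intro hausdorff_dist_unit_ball_le) auto
    then show "hausdorff_dist ?P (cball 0 1) < \<epsilon>"
      using \<eta>(3) assms(2) by linarith
  qed
qed

end
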